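(* For all $w_1,w_2\in\mathfrak{h}^1_{>0}$ and every integer $n\ge 1$, the following identity holds in $\mathbb{Q}[[q]]$: \[ \zeta_q\bigl(d(\phi(w_1\,\overline{*}\,w_2))\circledast_q z_1^{n}\bigr)+\sum_{\substack{k+l=n\\ k,l\ge 1}}\zeta_q\bigl(d(\phi(w_1))\circledast_q z_1^{k}\bigr)\,\zeta_q\bigl(d(\phi(w_2))\circledast_q z_1^{l}\bigr)=0, \] where $z_1^{m}$ denotes the word $z_1z_1\cdots z_1$ ($m$ letters).
   Context: Let $\hbar$ be an indeterminate and $\mathcal{C}=\mathbb{Q}[\hbar]$. Let $\mathfrak{h}^1$ be the non-commutative polynomial algebra over $\mathcal{C}$ freely generated by letters $z_1,z_2,z_3,\dots$; juxtaposition denotes the concatenation product, a word is a monomial $z_{k_1}\cdots z_{k_r}$ ($r\ge 0$, the empty word being $1$). Let $\mathfrak{h}^1_{>0}$ be the $\mathcal{C}$-span of nonempty words, and $\mathfrak{h}^0$ the $\mathcal{C}$-span of $1$ and of the words $z_{k_1}\cdots z_{k_r}$ with $r\ge1$, $k_1\ge 2$. Let $\mathfrak{z}$ be the $\mathcal{C}$-span of $z_1,z_2,\dots$. Products on $\mathfrak{z}$ ($\mathcal{C}$-bilinear): $z_i\circ z_j=z_{i+j}$ and $z_i\circ_{+}z_j=z_{i+j}+\hbar z_{i+j-1}$. These give actions of $\mathfrak{z}$ on $\mathfrak{h}^1$: $z_i\circ 1=0$, $z_i\circ(z_jw)=(z_i\circ z_j)w$, and likewise $z_i\circ_+1=0$,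 $z_i\circ_+(z_jw)=(z_i\circ_+z_j)w$, for $i,j\ge1$, $w\in\mathfrak{h}^1$, extended $\mathcal{C}$-bilinearly. The $\mathcal{C}$-bilinear product $*_+$ on $\mathfrak{h}^1$: $1*_+w=w*_+1=w$ and $(z_iw_1)*_+(z_jw_2)=z_i(w_1*_+z_jw_2)+z_j(z_iw_1*_+w_2)+(z_i\circ_+z_j)(w_1*_+w_2)$. The $\mathcal{C}$-bilinear product $\overline{*}$ on $\mathfrak{h}^1$: $1\,\overline{*}\,w=w\,\overline{*}\,1=w$ and $(z_iw_1)\,\overline{*}\,(z_jw_2)=z_i(w_1\,\overline{*}\,z_jw_2)+z_j(z_iw_1\,\overline{*}\,w_2)-z_{i+j}(w_1\,\overline{*}\,w_2)$. The $\mathcal{C}$-bilinear product $\circledast_q$ on $\mathfrak{h}^1_{>0}$: $(z_iw_1)\circledast_q(z_jw_2)=z_{i+j}(w_1*_+w_2)$ for $i,j\ge1$, $w_1,w_2\in\mathfrak{h}^1$. The $\mathcal{C}$-linear map $d:\mathfrak{h}^1\to\mathfrak{h}^1$ is defined by $d(1)=1$, $d(z_iw)=z_i\,d(w)+z_i\circ d(w)$. The $\mathcal{C}$-linear map $\phi:\mathfrak{h}^1\to\mathfrak{h}^1$: for a word $u=z_{k_1}\cdots z_{k_r}$ of weight $K=k_1+\dots+k_r$, let $I_u=\{k_1+\dots+k_j:1\le j<r\}$ and $\{1,\dots,K\}\setminus I_u=\{p_1<\dots<p_l\}$; then $\phi(u)=z_{p_1}z_{p_2-p_1}\cdots z_{p_l-p_{l-1}}$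 (and $\phi(1)=1$). Let $[m]=(1-q^m)/(1-q)$. For a word $z_{k_1}\cdots z_{k_r}\in\mathfrak{h}^0$ set $\zeta_q(z_{k_1}\cdots z_{k_r})=\sum_{m_1>\dots>m_r>0}\frac{q^{(k_1-1)m_1+\cdots+(k_r-1)m_r}}{[m_1]^{k_1}\cdots[m_r]^{k_r}}\in\mathbb{Q}[[q]]$, $\zeta_q(1)=1$, and extend $\zeta_q$ to $\mathfrak{h}^0$ $\mathcal{C}$-linearly, with $\hbar$ acting on $\mathbb{Q}[[q]]$ as multiplication by $1-q$. *)

theory Defs
  imports
    "HOL-Analysis.Infinite_Sum"
    "HOL-Library.Poly_Mapping"
    "HOL-Computational_Algebra.Computational_Algebra"
begin

text \<open>
  The free monoid: with lists as a monoid under concatenation, the type of finitely supported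
  functions \<open>nat list \<Rightarrow>\<^sub>0 rat poly\<close>, with the convolution product of \<open>Poly_Mapping\<close>, is the free
  associative algebra over \<open>\<rat>[\<hbar>]\<close>, and \<open>*\<close> is its concatenation product.
\<close>

instantiation list :: (type) monoid_add
begin

definition zero_list_def: "0 = ([] :: 'a list)"

definition plus_list_def: "xs + ys = (xs @ ys :: 'a list)"

instance
  by standard (simp_all add: zero_list_def plus_list_def)

end

type_synonym ncpoly = "nat list \<Rightarrow>\<^sub>0 rat poly"

text \<open>
  The list \<open>[k\<^sub>1, \<dots>, k\<^sub>r]\<close> stands for the word \<open>z\<^bsub>k\<^sub>1\<^esub> \<cdots> z\<^bsub>k\<^sub>r\<^esub>\<close>.  The type \<^typ>\<open>ncpoly\<close> also has a
  letter with index \<open>0\<close>; it is excluded by the carrier sets below, and the values of the maps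
  on words containing it carry no meaning.
\<close>

definition word :: "nat list \<Rightarrow> ncpoly" where
  "word u = Poly_Mapping.single u 1"

abbreviation z :: "nat \<Rightarrow> ncpoly" where
  "z k \<equiv> word [k]"

definition scalar :: "rat poly \<Rightarrow> ncpoly" where
  "scalar c = Poly_Mapping.single [] c"

definition hbar :: "rat poly" where
  "hbar = [:0, 1:]"

definition h1 :: "ncpoly set" where
  "h1 = {x. \<forall>u\<in>Poly_Mapping.keys x. 0 \<notin> set u}"

definition h1_pos :: "ncpoly set" where
  "h1_pos = {x. \<forall>u\<in>Poly_Mapping.keys x. u \<noteq> [] \<and> 0 \<notin> set u}"

definition h0 :: "ncpoly set" where
  "h0 = {x. \<forall>u\<in>Poly_Mapping.keys x. 0 \<notin> set u \<and> (u = [] \<or> hd u \<ge> 2)}"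

definition lin_ext :: "(nat list \<Rightarrow> ncpoly) \<Rightarrow> ncpoly \<Rightarrow> ncpoly" where
  "lin_ext f x = (\<Sum>u\<in>Poly_Mapping.keys x. scalar (Poly_Mapping.lookup x u) * f u)"

definition bilin_ext :: "(nat list \<Rightarrow> nat list \<Rightarrow> ncpoly) \<Rightarrow> ncpoly \<Rightarrow> ncpoly \<Rightarrow> ncpoly" where
  "bilin_ext f x y = lin_ext (\<lambda>u. lin_ext (f u) y) x"


definition circ_letter :: "nat \<Rightarrow> nat \<Rightarrow> ncpoly" where
  "circ_letter i j = z (i + j)"

definition circ_plus_letter :: "nat \<Rightarrow> nat \<Rightarrow> ncpoly" where
  "circ_plus_letter i j = z (i + j) + scalar hbar * z (i + j - 1)"

fun circ_word :: "nat \<Rightarrow> nat list \<Rightarrow> ncpoly" where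
  "circ_word i [] = 0"
| "circ_word i (j # w) = circ_letter i j * word w"

definition circ_act :: "nat \<Rightarrow> ncpoly \<Rightarrow> ncpoly" where
  "circ_act i = lin_ext (circ_word i)"

fun star_plus_word :: "nat list \<Rightarrow> nat list \<Rightarrow> ncpoly" where
  "star_plus_word [] w = word w"
| "star_plus_word (i # w1) [] = word (i # w1)"
| "star_plus_word (i # w1) (j # w2) =
     z i * star_plus_word w1 (j # w2) + z j * star_plus_word (i # w1) w2
     + circ_plus_letter i j * star_plus_word w1 w2"

definition star_plus :: "ncpoly \<Rightarrow> ncpoly \<Rightarrow> ncpoly" (infixl \<open>*\<^sub>+\<close> 70) where
  "star_plus = bilin_ext star_plus_word"

fun star_bar_word :: "nat list \<Rightarrow> nat list \<Rightarrow> ncpoly" where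
  "star_bar_word [] w = word w"
| "star_bar_word (i # w1) [] = word (i # w1)"
| "star_bar_word (i # w1) (j # w2) =
     z i * star_bar_word w1 (j # w2) + z j * star_bar_word (i # w1) w2
     - z (i + j) * star_bar_word w1 w2"

definition star_bar :: "ncpoly \<Rightarrow> ncpoly \<Rightarrow> ncpoly" where
  "star_bar = bilin_ext star_bar_word"

text \<open>The product \<open>\<circledast>\<^sub>q\<close> lives on \<^const>\<open>h1_pos\<close>; the value \<open>0\<close> on the empty word is a dummy.\<close>

fun circledast_word :: "nat list \<Rightarrow> nat list \<Rightarrow> ncpoly" where
  "circledast_word (i # w1) (j # w2) = z (i + j) * (word w1 *\<^sub>+ word w2)"
| "circledast_word _ _ = 0"

definition circledast :: "ncpoly \<Rightarrow> ncpoly \<Rightarrow> ncpoly" where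
  "circledast = bilin_ext circledast_word"

fun d_word :: "nat list \<Rightarrow> ncpoly" where
  "d_word [] = 1"
| "d_word (i # w) = z i * d_word w + circ_act i (d_word w)"

definition d_map :: "ncpoly \<Rightarrow> ncpoly" where
  "d_map = lin_ext d_word"

definition partial_sums :: "nat list \<Rightarrow> nat set" where
  "partial_sums u = {sum_list (take j u) | j. 1 \<le> j \<and> j < length u}"

definition phi_list :: "nat list \<Rightarrow> nat list" where
  "phi_list u =
     (let p = sorted_list_of_set ({1..sum_list u} - partial_sums u)
      in map2 (\<lambda>a b. a - b) p (0 # butlast p))"

definition phi :: "ncpoly \<Rightarrow> ncpoly" where
  "phi = lin_ext (\<lambda>u. word (phi_list u))"


definition q_int :: "nat \<Rightarrow> rat fps" where
  "q_int m = (1 - fps_X ^ m) / (1 - fps_X)"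

text \<open>
  The infinite sum is taken in the \<open>q\<close>-adic topology of \<open>\<rat>[[q]]\<close>; it converges for words
  in \<^const>\<open>h0\<close>.  The index set consists of the tuples \<open>m\<^sub>1 > \<cdots> > m\<^sub>r > 0\<close>, so for the
  empty word the sum is over the empty tuple alone and has the value \<open>1\<close>.
\<close>

definition zeta_q_word :: "nat list \<Rightarrow> rat fps" where
  "zeta_q_word k =
     infsum (\<lambda>m. fps_X ^ (\<Sum>j<length k. (k ! j - 1) * m ! j) / (\<Prod>j<length k. q_int (m ! j) ^ (k ! j)))
       {m. length m = length k \<and> sorted_wrt (>) m \<and> 0 \<notin> set m}"

text \<open>The scalar \<open>\<hbar>\<close> acts on \<open>\<rat>[[q]]\<close> as multiplication by \<open>1 - q\<close>.\<close>

definition scalar_q :: "rat poly \<Rightarrow> rat fps" where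
  "scalar_q c = poly (map_poly fps_const c) (1 - fps_X)"

definition zeta_q :: "ncpoly \<Rightarrow> rat fps" where
  "zeta_q x = (\<Sum>u\<in>Poly_Mapping.keys x. scalar_q (Poly_Mapping.lookup x u) * zeta_q_word u)"

lemma zeta_q_word_Nil: "zeta_q_word [] = 1"
proof -
  have "{m::nat list. length m = length ([]::nat list) \<and> sorted_wrt (>) m \<and> 0 \<notin> set m} = {[]}"
    by auto
  moreover have "((\<lambda>m::nat list. 1 :: rat fps) has_sum 1) {[]}"
    unfolding has_sum_def by (rule tendsto_eventually) (simp add: eventually_finite_subsets_at_top_finite)
  moreover from this have "infsum (\<lambda>m::nat list. 1 :: rat fps) {[]} = 1"
    by (simp add: infsum_def summable_on_def)
       (metis tendsto_Lim has_sum_def finite_subsets_at_top_neq_bot)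
  ultimately show ?thesis
    by (simp add: zeta_q_word_def)
qed

text \<open>
  The arguments of \<^const>\<open>zeta_q\<close> that occur in the identity lie in its domain \<^const>\<open>h0\<close>.
\<close>

definition over :: "nat list set \<Rightarrow> ncpoly set" where
  "over S = {x. Poly_Mapping.keys x \<subseteq> S}"

lemma over_zero: "0 \<in> over S"
  by (simp add: over_def)

lemma over_add: "x \<in> over S \<Longrightarrow> y \<in> over S \<Longrightarrow> x + y \<in> over S"
  using Poly_Mapping.keys_add[of x y] by (auto simp: over_def)

lemma over_diff: "x \<in> over S \<Longrightarrow> y \<in> over S \<Longrightarrow> x - y \<in> over S"
  using Poly_Mapping.keys_diff[of x y] by (auto simp: over_def)

lemma over_sum: "(\<And>i. i \<in> A \<Longrightarrow> f i \<in> over S) \<Longrightarrow> sum f A \<in> over S"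
  by (induction A rule: infinite_finite_induct) (auto intro: over_add over_zero)

lemma over_word: "u \<in> S \<Longrightarrow> word u \<in> over S"
  by (auto simp: over_def word_def)

lemma over_mult:
  assumes "x \<in> over S" "y \<in> over T" "\<And>u v. u \<in> S \<Longrightarrow> v \<in> T \<Longrightarrow> u @ v \<in> R"
  shows "x * y \<in> over R"
proof -
  have "Poly_Mapping.keys (x * y) \<subseteq> {a + b |a b. a \<in> Poly_Mapping.keys x \<and> b \<in> Poly_Mapping.keys y}"
    by (rule Poly_Mapping.keys_mult)
  with assms show ?thesis
    by (fastforce simp: over_def plus_list_def)
qed

lemma over_scalar_mult: "x \<in> over S \<Longrightarrow> scalar c * x \<in> over S"
  by (rule over_mult[of _ "{[]}" _ S]) (auto simp: over_def scalar_def)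

lemma over_lin_ext:
  assumes "x \<in> over S" "\<And>u. u \<in> S \<Longrightarrow> f u \<in> over T"
  shows "lin_ext f x \<in> over T"
  unfolding lin_ext_def
  by (intro over_sum over_scalar_mult assms(2)) (use assms(1) in \<open>auto simp: over_def\<close>)

lemma over_bilin_ext:
  assumes "x \<in> over S" "y \<in> over T" "\<And>u v. u \<in> S \<Longrightarrow> v \<in> T \<Longrightarrow> f u v \<in> over R"
  shows "bilin_ext f x y \<in> over R"
  unfolding bilin_ext_def by (intro over_lin_ext[OF assms(1)] over_lin_ext[OF assms(2)] assms(3))

lemma carriers_over:
  "h1 = over {u. 0 \<notin> set u}"
  "h1_pos = over {u. u \<noteq> [] \<and> 0 \<notin> set u}"
  "h0 = over {u. 0 \<notin> set u \<and> (u = [] \<or> hd u \<ge> 2)}"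
  by (auto simp: h1_def h1_pos_def h0_def over_def)

lemma over_letter_mult:
  assumes "x \<in> over {u. 0 \<notin> set u}" "i > 0"
  shows "z i * x \<in> over {u. u \<noteq> [] \<and> 0 \<notin> set u}" "z i * x \<in> h1"
  using assms
  by (auto intro!: over_mult[of "z i" "{[i]}" x] over_word simp: carriers_over)

lemma star_plus_word_h1:
  "0 \<notin> set u \<Longrightarrow> 0 \<notin> set v \<Longrightarrow> star_plus_word u v \<in> h1"
proof (induction u v rule: star_plus_word.induct)
  case (3 i u j v)
  have "circ_plus_letter i j \<in> h1"
    using 3 unfolding carriers_over circ_plus_letter_def
    by (intro over_add over_scalar_mult over_word) auto
  then have "circ_plus_letter i j * star_plus_word u v \<in> h1"
    using 3 unfolding carriers_over by (auto intro: over_mult)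
  with 3 show ?case
    by (auto intro!: over_add over_letter_mult(2)[unfolded carriers_over] simp: carriers_over)
qed (auto simp: carriers_over intro: over_word)

lemma star_bar_word_h1_pos:
  "0 \<notin> set u \<Longrightarrow> 0 \<notin> set v \<Longrightarrow> u \<noteq> [] \<or> v \<noteq> [] \<Longrightarrow> star_bar_word u v \<in> h1_pos"
proof (induction u v rule: star_bar_word.induct)
  case (3 i u j v)
  have *: "star_bar_word u v \<in> over {u. 0 \<notin> set u}"
  proof (cases "u = [] \<and> v = []")
    case False
    with 3 show ?thesis by (auto simp: carriers_over over_def)
  qed (auto intro: over_word)
  have "star_bar_word u (j # v) \<in> over {u. 0 \<notin> set u}" "star_bar_word (i # u) v \<in> over {u. 0 \<notin> set u}"
    using 3 by (auto simp: carriers_over over_def)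
  with * 3 show ?case
    unfolding carriers_over by (auto intro!: over_add over_diff over_letter_mult(1))
qed (auto simp: carriers_over intro: over_word)

lemma star_bar_h1_pos: "x \<in> h1_pos \<Longrightarrow> y \<in> h1_pos \<Longrightarrow> star_bar x y \<in> h1_pos"
  unfolding star_bar_def using star_bar_word_h1_pos
  by (auto simp: carriers_over intro!: over_bilin_ext)

lemma d_word_h1:
  "0 \<notin> set u \<Longrightarrow> d_word u \<in> h1 \<and> (u \<noteq> [] \<longrightarrow> d_word u \<in> h1_pos)"
proof (induction u)
  case Nil
  have "(1 :: ncpoly) = word []"
    by (simp add: word_def flip: zero_list_def single_one)
  then have "(1 :: ncpoly) \<in> over {u. 0 \<notin> set u}"
    using over_word[of "[]" "{u. 0 \<notin> set u}"] by simp
  then show ?case by (simp add: carriers_over)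
next
  case (Cons i u)
  have "circ_word i v \<in> over {u. u \<noteq> [] \<and> 0 \<notin> set u}" if "0 \<notin> set v" for v
    using that Cons.prems
    by (cases v) (auto simp: circ_letter_def intro!: over_zero over_letter_mult(1) over_word)
  then have "circ_act i (d_word u) \<in> over {u. u \<noteq> [] \<and> 0 \<notin> set u}"
    unfolding circ_act_def
    using Cons by (intro over_lin_ext[of _ "{u. 0 \<notin> set u}"]) (auto simp: carriers_over)
  then have "d_word (i # u) \<in> over {u. u \<noteq> [] \<and> 0 \<notin> set u}"
    using Cons by (auto intro!: over_add over_letter_mult(1) simp: carriers_over)
  then show ?case by (auto simp: carriers_over over_def)
qed

lemma d_map_h1_pos: "x \<in> h1_pos \<Longrightarrow> d_map x \<in> h1_pos"
  unfolding d_map_def using d_word_h1 by (auto simp: carriers_over intro!: over_lin_ext)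

lemma phi_list_pos:
  assumes "u \<noteq> []" "0 \<notin> set u"
  shows "phi_list u \<noteq> [] \<and> 0 \<notin> set (phi_list u)"
proof -
  define A where "A = {1..sum_list u} - partial_sums u"
  define p where "p = sorted_list_of_set A"
  have fin: "finite A" by (simp add: A_def)
  have "sum_list u \<notin> partial_sums u"
  proof
    assume "sum_list u \<in> partial_sums u"
    then obtain j where j: "j < length u" "sum_list u = sum_list (take j u)"
      by (auto simp: partial_sums_def)
    have "sum_list u = sum_list (take j u) + sum_list (drop j u)"
      by (metis append_take_drop_id sum_list_append)
    with j have "sum_list (drop j u) = 0" by simp
    moreover have "drop j u = u ! j # drop (Suc j) u" using j by (simp add: Cons_nth_drop_Suc)
    ultimately have "u ! j = 0" by simp
    with j assms show False by (metis nth_mem)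
  qed
  moreover have "sum_list u > 0" using assms by (cases u) auto
  ultimately have "sum_list u \<in> A" by (auto simp: A_def)
  then have ne: "p \<noteq> []" using fin unfolding p_def by auto
  have sp: "sorted_wrt (<) p" unfolding p_def by (rule strict_sorted_list_of_set)
  have pos: "\<forall>a\<in>set p. a > 0" using fin unfolding p_def by (auto simp: A_def)
  have "map2 (\<lambda>a b. a - b) p (0 # butlast p) ! i > 0" if "i < length p" for i
  proof (cases i)
    case 0
    with that pos show ?thesis by (simp add: nth_mem)
  next
    case (Suc j)
    with that have "p ! j < p ! i" using sp by (auto simp: sorted_wrt_iff_nth_less)
    with that Suc show ?thesis by (simp add: nth_butlast)
  qed
  moreover have "length (map2 (\<lambda>a b. a - b) p (0 # butlast p)) = length p"
    using ne by (cases p) auto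
  ultimately have "0 \<notin> set (map2 (\<lambda>a b. a - b) p (0 # butlast p))"
    by (metis in_set_conv_nth less_irrefl)
  moreover have "map2 (\<lambda>a b. a - b) p (0 # butlast p) \<noteq> []" using ne by (cases p) auto
  ultimately show ?thesis by (simp add: phi_list_def p_def A_def Let_def)
qed

lemma phi_h1_pos: "x \<in> h1_pos \<Longrightarrow> phi x \<in> h1_pos"
  unfolding phi_def using phi_list_pos
  by (auto simp: carriers_over intro!: over_lin_ext over_word)

lemma circledast_h0:
  assumes "x \<in> h1_pos" "y \<in> h1_pos"
  shows "circledast x y \<in> h0"
proof -
  have "circledast_word u v \<in> h0"
    if uv: "u \<noteq> [] \<and> 0 \<notin> set u" "v \<noteq> [] \<and> 0 \<notin> set v" for u v
  proof -
    obtain i u' j v' where e: "u = i # u'" "v = j # v'" using uv by (metis list.exhaust)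
    have "word u' *\<^sub>+ word v' \<in> over {u. 0 \<notin> set u}"
      unfolding star_plus_def
      by (rule over_bilin_ext[of _ "{u'}" _ "{v'}"])
         (use uv e star_plus_word_h1[of u' v'] in \<open>auto intro: over_word simp: carriers_over\<close>)
    then have "z (i + j) * (word u' *\<^sub>+ word v') \<in> over {u. 0 \<notin> set u \<and> (u = [] \<or> hd u \<ge> 2)}"
      by (rule over_mult[of _ "{[i + j]}", rotated]) (use uv e in \<open>auto intro: over_word\<close>)
    then show ?thesis by (simp add: e carriers_over)
  qed
  with assms show ?thesis
    unfolding circledast_def carriers_over by (auto intro!: over_bilin_ext)
qed

lemma z_power_h1_pos: "n \<ge> 1 \<Longrightarrow> z 1 ^ n \<in> h1_pos"
proof (induction n rule: dec_induct)
  case base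
  show ?case by (auto simp: carriers_over intro: over_word)
next
  case (step n)
  then have "z 1 ^ n \<in> over {u. 0 \<notin> set u}" by (auto simp: carriers_over over_def)
  then show ?case by (simp add: carriers_over over_letter_mult(1))
qed

end

theory Submission
  imports Defs
begin

text \<open>
  For a word \<open>u\<close> put \<open>F\<^sub>u(t) = \<Sum>\<^sub>n \<zeta>\<^sub>q(d(\<phi>(u)) \<circledast>\<^sub>q z\<^sub>1\<^sup>n) t\<^sup>n\<close>, a power series whose \<open>n\<close>-th coefficient
  is divisible by \<open>q\<^sup>n\<close>.  It equals \<open>\<Sum>\<^sub>m b(m) (t/[m]) \<Prod>\<^bsub>j<m\<^esub> (1 + t/[j])\<close>, where \<open>b(m)\<close> is the part
  of the nested sum of \<open>d(\<phi>(u))\<close> with largest index \<open>m\<close>.  At \<open>t = -[N]\<close> this terminates and becomes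
  a \<open>q\<close>-Newton series, and a \<open>q\<close>-analogue of Hoffman's duality gives \<open>F\<^sub>u(-[N]) = -S\<^sub>u(N)\<close> with
  \<open>S\<^sub>u(N) = \<Sum> \<Prod> (q\<^bsup>m\<^sub>i\<^esup>/[m\<^sub>i])\<^bsup>k\<^sub>i\<^esup>\<close> over \<open>N \<ge> m\<^sub>1 \<ge> \<cdots> \<ge> m\<^sub>r \<ge> 1\<close>.  These finite sums multiply
  according to the product \<open>star_bar\<close>, so \<open>F\<close> of the product plus the product of the \<open>F\<close>s vanishes at every \<open>-[N]\<close>.
  A series in \<open>t\<close> with coefficients divisible by \<open>q\<^sup>n\<close> has only finitely many zeros unless it is \<open>0\<close>,
  and comparing the coefficients of \<open>t\<^sup>n\<close> gives the relation.
\<close>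

section \<open>Formal sums of power series\<close>

text \<open>Coefficient j only sees n <= j. If \<open>fps_X ^ n\<close> divides \<open>g n\<close>,
  the later terms do not reach it, and this is the q-adic sum of the family.\<close>

definition psum :: "(nat \<Rightarrow> 'a::comm_ring_1 fps) \<Rightarrow> 'a fps" where
  "psum g = Abs_fps (\<lambda>j. \<Sum>n\<le>j. fps_nth (g n) j)"

lemma fps_X_power_dvd_iff:
  "fps_X ^ n dvd (f :: 'a::comm_ring_1 fps) \<longleftrightarrow> (\<forall>j<n. fps_nth f j = 0)"
proof
  assume "fps_X ^ n dvd f"
  then obtain h where "f = fps_X ^ n * h" by (rule dvdE)
  then show "\<forall>j<n. fps_nth f j = 0" by (simp add: fps_X_power_mult_nth)
next
  assume "\<forall>j<n. fps_nth f j = 0"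
  then have "f = fps_X ^ n * Abs_fps (\<lambda>j. fps_nth f (j + n))"
    by (intro fps_ext) (simp add: fps_X_power_mult_nth)
  then show "fps_X ^ n dvd f" by (rule dvdI)
qed

lemma fps_eq_zero_if_all_fps_X_powers_dvd:
  "(\<And>n. fps_X ^ n dvd (f :: 'a::comm_ring_1 fps)) \<Longrightarrow> f = 0"
  by (rule fps_ext) (metis fps_X_power_dvd_iff fps_zero_nth lessI)

text \<open>Terms beyond j vanish at coefficient j, so one common cutoff serves all the coefficients
  entering a convolution.\<close>

lemma fps_nth_psum:
  assumes "\<And>n. fps_X ^ n dvd g n" "j \<le> J"
  shows "fps_nth (psum g) j = fps_nth (\<Sum>n\<le>J. g n) j"
proof -
  have "(\<Sum>n\<le>J. fps_nth (g n) j) = (\<Sum>n\<le>j. fps_nth (g n) j)"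
    using assms by (intro sum.mono_neutral_right) (auto simp: fps_X_power_dvd_iff)
  then show ?thesis by (simp add: psum_def fps_sum_nth)
qed

lemma psum_add: "psum (\<lambda>n. f n + g n) = psum f + psum g"
  by (rule fps_ext) (simp add: psum_def sum.distrib)

lemma psum_sum: "psum (\<lambda>n. \<Sum>i\<in>I. f i n) = (\<Sum>i\<in>I. psum (f i))"
  by (induction I rule: infinite_finite_induct) (simp_all add: psum_add, simp_all add: psum_def fps_eq_iff)

lemma psum_cmult:
  assumes "\<And>n. fps_X ^ n dvd g n"
  shows "psum (\<lambda>n. c * g n) = c * psum g"
proof (rule fps_ext)
  fix j
  have "fps_nth (c * psum g) j = (\<Sum>i=0..j. fps_nth c i * fps_nth (\<Sum>n\<le>j. g n) (j - i))"
    unfolding fps_mult_nth using assms by (intro sum.cong refl) (simp add: fps_nth_psum[of g _ j])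
  also have "\<dots> = fps_nth (c * (\<Sum>n\<le>j. g n)) j"
    by (simp add: fps_mult_nth)
  finally show "fps_nth (psum (\<lambda>n. c * g n)) j = fps_nth (c * psum g) j"
    by (simp add: psum_def sum_distrib_left fps_sum_nth)
qed

lemma psum_finite:
  assumes "\<And>n. fps_X ^ n dvd g n" "\<And>n. n \<ge> N \<Longrightarrow> g n = 0"
  shows "psum g = (\<Sum>n<N. g n)"
proof (rule fps_ext)
  fix j
  have "fps_nth (psum g) j = fps_nth (\<Sum>n\<le>max j N. g n) j"
    using assms by (intro fps_nth_psum) auto
  also have "(\<Sum>n\<le>max j N. g n) = (\<Sum>n<N. g n)"
    using assms(2) by (intro sum.mono_neutral_right) auto
  finally show "fps_nth (psum g) j = fps_nth (\<Sum>n<N. g n) j" .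
qed

lemma psum_swap: "psum (\<lambda>n. psum (\<lambda>m. g n m)) = psum (\<lambda>m. psum (\<lambda>n. g n m))"
  by (rule fps_ext) (simp add: psum_def, rule sum.swap)

lemma psum_dvd: "(\<And>m. fps_X ^ n dvd g m) \<Longrightarrow> fps_X ^ n dvd psum g"
  by (simp add: psum_def fps_X_power_dvd_iff)

lemma psum_shift:
  assumes "\<And>n. fps_X ^ n dvd g n"
  shows "psum g = g 0 + psum (\<lambda>n. g (Suc n))"
proof (rule fps_ext)
  fix j
  \<comment> \<open>Cutoff \<open>Suc j\<close> leaves, after splitting off n = 0, the cutoff j of
    \<open>psum\<close>.\<close>
  have "fps_nth (psum g) j = fps_nth (\<Sum>n\<le>Suc j. g n) j"
    using assms by (intro fps_nth_psum) auto
  also have "\<dots> = fps_nth (g 0) j + (\<Sum>n\<le>j. fps_nth (g (Suc n)) j)"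
    by (subst sum.atMost_Suc_shift) (simp add: fps_sum_nth)
  finally show "fps_nth (psum g) j = fps_nth (g 0 + psum (\<lambda>n. g (Suc n))) j"
    by (simp add: psum_def)
qed

text \<open>The point t may have a nonzero constant term; convergence rests on the divisibility of
  \<open>Z n\<close> by \<open>fps_X ^ n\<close>.\<close>

definition ps_eval :: "(nat \<Rightarrow> 'a::comm_ring_1 fps) \<Rightarrow> 'a fps \<Rightarrow> 'a fps" where
  "ps_eval Z t = psum (\<lambda>n. Z n * t ^ n)"

lemma ps_eval_mult:
  assumes "\<And>n. fps_X ^ n dvd Y n" "\<And>n. fps_X ^ n dvd Z n"
  shows "ps_eval (\<lambda>n. \<Sum>k\<le>n. Y k * Z (n - k)) t = ps_eval Y t * ps_eval Z t"
proof (rule fps_ext)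
  fix j
  define y where "y n = Y n * t ^ n" for n
  define z where "z n = Z n * t ^ n" for n
  have y: "fps_X ^ n dvd y n" and z: "fps_X ^ n dvd z n" for n
    using assms by (auto simp: y_def z_def)
  have "fps_nth (psum y * psum z) j = fps_nth ((\<Sum>n\<le>j. y n) * (\<Sum>n\<le>j. z n)) j"
    unfolding fps_mult_nth using y z
    by (intro sum.cong refl) (simp add: fps_nth_psum[of _ _ j])
  also have "(\<Sum>n\<le>j. y n) * (\<Sum>n\<le>j. z n) = (\<Sum>(k,l)\<in>{..j}\<times>{..j}. y k * z l)"
    by (simp add: sum_product sum.cartesian_product)
  also have "fps_nth \<dots> j = (\<Sum>(k,l)\<in>{..j}\<times>{..j}. fps_nth (y k * z l) j)"
    by (simp add: fps_sum_nth case_prod_unfold)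
  \<comment> \<open>q^(k+l) divides the product, so pairs with k + l > j drop out, and the remaining
    triangle is grouped by n = k + l.\<close>
  also have "\<dots> = (\<Sum>(k,l)\<in>{(k,l). k + l \<le> j}. fps_nth (y k * z l) j)"
  proof (intro sum.mono_neutral_right ballI)
    fix p assume p: "p \<in> {..j}\<times>{..j} - {(k,l). k + l \<le> j}"
    have "fps_X ^ (fst p + snd p) dvd y (fst p) * z (snd p)"
      using y z by (simp add: power_add mult_dvd_mono)
    with p show "(case p of (k,l) \<Rightarrow> fps_nth (y k * z l) j) = 0"
      by (auto simp: fps_X_power_dvd_iff)
  qed auto
  also have "\<dots> = (\<Sum>n\<le>j. \<Sum>k\<le>n. fps_nth (y k * z (n - k)) j)"
    by (rule sum.triangle_reindex_eq)
  also have "\<dots> = fps_nth (psum (\<lambda>n. (\<Sum>k\<le>n. Y k * Z (n - k)) * t ^ n)) j"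
  proof -
    have "(\<Sum>k\<le>n. y k * z (n - k)) = (\<Sum>k\<le>n. Y k * Z (n - k)) * t ^ n" for n
      unfolding sum_distrib_right
    proof (intro sum.cong refl)
      fix k assume "k \<in> {..n}"
      then have "t ^ n = t ^ k * t ^ (n - k)" by (simp flip: power_add)
      then show "y k * z (n - k) = Y k * Z (n - k) * t ^ n" by (simp add: y_def z_def)
    qed
    then show ?thesis unfolding psum_def by (simp flip: fps_sum_nth)
  qed
  finally show "fps_nth (ps_eval (\<lambda>n. \<Sum>k\<le>n. Y k * Z (n - k)) t) j = fps_nth (ps_eval Y t * ps_eval Z t) j"
    by (simp add: ps_eval_def y_def z_def)
qed

lemma ps_eval_add: "ps_eval (\<lambda>n. Y n + Z n) t = ps_eval Y t + ps_eval Z t"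
  by (simp add: ps_eval_def ring_distribs psum_add)

lemma ps_eval_shift:
  assumes "\<And>n. fps_X ^ n dvd Z n"
  shows "ps_eval Z t = Z 0 + t * ps_eval (\<lambda>n. Z (Suc n)) t"
proof -
  have "fps_X ^ n dvd Z (Suc n) * t ^ n" for n
    using assms[of "Suc n"] by (metis dvd_mult2 dvd_mult_right power_Suc)
  then have "psum (\<lambda>n. t * (Z (Suc n) * t ^ n)) = t * psum (\<lambda>n. Z (Suc n) * t ^ n)"
    by (rule psum_cmult)
  moreover have "psum (\<lambda>n. Z n * t ^ n) = Z 0 + psum (\<lambda>n. t * (Z (Suc n) * t ^ n))"
    using assms by (subst psum_shift) (simp_all add: mult_ac)
  ultimately show ?thesis by (simp add: ps_eval_def)
qed

text \<open>Each zero splits off a linear factor, and the cofactor is divisible by one more power of \<open>q\<close>.\<close>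

lemma infinite_zeros_imp_dvd:
  fixes G :: "nat \<Rightarrow> 'a::idom fps"
  assumes "\<And>n. fps_X ^ (n + s) dvd G n" "infinite {t. ps_eval G t = 0}"
  shows "fps_X ^ (s + r) dvd G n"
  using assms
proof (induction r arbitrary: G s n)
  case 0
  then show ?case by (metis add.commute add_0_right dvd_mult_left power_add)
next
  case (Suc r)
  from Suc.prems(2) obtain a where a: "ps_eval G a = 0"
    by (metis (mono_tags) finite.emptyI mem_Collect_eq subsetI finite_subset)
  \<comment> \<open>Synthetic division by t - a: the coefficients of the quotient are the tails of G
    evaluated at a. \<open>G0\<close> and \<open>GS\<close> compare coefficients in G = (t - a) H,
    the first by G(a) = 0.\<close>
  define H where "H n = ps_eval (\<lambda>i. G (Suc n + i)) a" for n
  have Hdvd: "fps_X ^ (n + Suc s) dvd H n" for n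
    unfolding H_def ps_eval_def
  proof (intro psum_dvd dvd_mult2)
    fix m
    have "n + Suc s \<le> Suc n + m + s" by simp
    then show "fps_X ^ (n + Suc s) dvd G (Suc n + m)"
      using Suc.prems(1) by (meson dvd_trans le_imp_power_dvd)
  qed
  have dvd: "fps_X ^ i dvd G (n + i)" for n i
    using Suc.prems(1)[of "n + i"] by (meson dvd_trans le_imp_power_dvd le_add2 le_add1 order_trans)
  have G0: "G 0 = - a * H 0"
    using ps_eval_shift[of G a] dvd[of _ 0] a by (simp add: H_def eq_neg_iff_add_eq_0)
  have GS: "G (Suc n) = H n - a * H (Suc n)" for n
    using ps_eval_shift[of "\<lambda>i. G (Suc n + i)" a] dvd[of _ "Suc n"] by (simp add: H_def)
  have roots: "ps_eval G t = (t - a) * ps_eval H t" for t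
  proof -
    have Hd: "fps_X ^ n dvd H n" for n
      using Hdvd[of n] by (metis dvd_mult_left power_add)
    then have Hd': "fps_X ^ n dvd H (Suc n)" for n
      by (metis dvd_mult_right power_Suc)
    have "ps_eval (\<lambda>n. G (Suc n)) t = ps_eval (\<lambda>n. H n + - a * H (Suc n)) t"
      by (simp add: GS)
    also have "\<dots> = ps_eval H t + (- a) * ps_eval (\<lambda>n. H (Suc n)) t"
      unfolding ps_eval_add unfolding ps_eval_def mult.assoc
      by (subst psum_cmult) (use Hd' in auto)
    finally have 1: "ps_eval (\<lambda>n. G (Suc n)) t = ps_eval H t + (- a) * ps_eval (\<lambda>n. H (Suc n)) t" .
    have 2: "ps_eval H t = H 0 + t * ps_eval (\<lambda>n. H (Suc n)) t"
      by (rule ps_eval_shift) (rule Hd)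
    have 3: "ps_eval G t = G 0 + t * ps_eval (\<lambda>n. G (Suc n)) t"
      by (rule ps_eval_shift) (use dvd[of _ 0] in simp)
    show ?thesis unfolding 3 1 G0 using 2 by (simp add: algebra_simps)
  qed
  \<comment> \<open>In an integral domain every zero of G other than a is a zero of H.\<close>
  have "{t. ps_eval G t = 0} \<subseteq> insert a {t. ps_eval H t = 0}"
    by (auto simp: roots)
  with Suc.prems(2) have inf: "infinite {t. ps_eval H t = 0}"
    by (meson finite_insert finite_subset)
  have *: "fps_X ^ (Suc s + r) dvd H n" for n
    using Suc.IH[of "Suc s" H, OF Hdvd inf] by simp
  show ?case
    using *[of n] *[of "n - 1"] *[of 0]
    by (cases n) (auto simp: G0 GS intro!: dvd_diff)
qed

text \<open>A Strassmann-type theorem: with s = 0 and r arbitrary, every power of q divides each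
  coefficient.\<close>

lemma infinite_zeros_imp_zero:
  fixes G :: "nat \<Rightarrow> 'a::idom fps"
  assumes "\<And>n. fps_X ^ n dvd G n" "infinite {t. ps_eval G t = 0}"
  shows "G n = 0"
  using infinite_zeros_imp_dvd[of 0 G _ n] assms
  by (intro fps_eq_zero_if_all_fps_X_powers_dvd) simp

text \<open>q-adic convergence means that each coefficient stabilises; \<open>F j\<close> contains
  all indices that affect coefficient j.\<close>

lemma has_sum_fpsI:
  fixes f :: "'i \<Rightarrow> 'a::comm_ring_1 fps"
  assumes "\<And>j. finite (F j)" "\<And>j. F j \<subseteq> A"
    and "\<And>i j. i \<in> A - F j \<Longrightarrow> fps_nth (f i) j = 0"
    and "\<And>j. fps_nth S j = (\<Sum>i\<in>F j. fps_nth (f i) j)"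
  shows "(f has_sum S) A"
  unfolding has_sum_def
proof (rule tendsto_fpsI)
  fix j
  show "\<forall>\<^sub>F Y in finite_subsets_at_top A. fps_nth (sum f Y) j = fps_nth S j"
    unfolding eventually_finite_subsets_at_top
  proof (intro exI[of _ "F j"] conjI allI impI)
    fix Y assume Y: "finite Y \<and> F j \<subseteq> Y \<and> Y \<subseteq> A"
    have "(\<Sum>i\<in>Y. fps_nth (f i) j) = (\<Sum>i\<in>F j. fps_nth (f i) j)"
      using Y assms(3)[of _ j] by (intro sum.mono_neutral_right) auto
    then show "fps_nth (sum f Y) j = fps_nth S j"
      by (simp add: fps_sum_nth assms(4))
  qed (use assms in auto)
qed

section \<open>Linear functionals on the free algebra\<close>

lemma scalar_q_add: "scalar_q (a + b) = scalar_q a + scalar_q b"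
proof -
  have "map_poly fps_const (a + b) = map_poly fps_const a + map_poly fps_const b"
    by (rule poly_eqI) (simp add: coeff_map_poly flip: fps_const_add)
  then show ?thesis by (simp add: scalar_q_def)
qed

lemma scalar_q_uminus: "scalar_q (- a) = - scalar_q a"
proof -
  have "map_poly fps_const (- a) = - map_poly fps_const a"
    by (rule poly_eqI) (simp add: coeff_map_poly flip: fps_const_neg)
  then show ?thesis by (simp add: scalar_q_def)
qed

lemma scalar_q_mult: "scalar_q (a * b) = scalar_q a * scalar_q b"
proof -
  have smult: "map_poly fps_const (smult c p) = smult (fps_const c) (map_poly fps_const p)" for c p
    by (rule poly_eqI) (simp add: coeff_map_poly flip: fps_const_mult)
  show ?thesis
    by (induction a)
       (simp_all add: scalar_q_add smult map_poly_pCons mult_pCons_left algebra_simps,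
        simp_all add: scalar_q_def smult map_poly_pCons algebra_simps)
qed

lemma scalar_q_0 [simp]: "scalar_q 0 = 0"
  by (simp add: scalar_q_def)

lemma scalar_q_1 [simp]: "scalar_q 1 = 1"
  by (simp add: scalar_q_def one_pCons map_poly_pCons)

lemma scalar_q_hbar [simp]: "scalar_q hbar = 1 - fps_X"
  by (simp add: scalar_q_def hbar_def map_poly_pCons)

text \<open>\<open>zeta_q\<close> is the instance \<open>zeta_q_word\<close>; finite harmonic sums
  and Newton transforms are extended from words in the same way, with hbar acting as 1 - q.\<close>

definition lin_eval :: "(nat list \<Rightarrow> rat fps) \<Rightarrow> ncpoly \<Rightarrow> rat fps" where
  "lin_eval f x = (\<Sum>u\<in>Poly_Mapping.keys x. scalar_q (Poly_Mapping.lookup x u) * f u)"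

lemma lin_eval_superset:
  assumes "finite S" "Poly_Mapping.keys x \<subseteq> S"
  shows "lin_eval f x = (\<Sum>u\<in>S. scalar_q (Poly_Mapping.lookup x u) * f u)"
  unfolding lin_eval_def using assms
  by (intro sum.mono_neutral_left) (auto simp: in_keys_iff)

lemma lin_eval_add: "lin_eval f (x + y) = lin_eval f x + lin_eval f y"
proof -
  have "Poly_Mapping.keys (x + y) \<subseteq> Poly_Mapping.keys x \<union> Poly_Mapping.keys y"
    by (rule Poly_Mapping.keys_add)
  then show ?thesis
    by (simp add: lin_eval_superset[of "Poly_Mapping.keys x \<union> Poly_Mapping.keys y"]
        lookup_add scalar_q_add distrib_right sum.distrib)
qed

lemma lin_eval_uminus: "lin_eval f (- x) = - lin_eval f x"
  by (simp add: lin_eval_def scalar_q_uminus sum_negf)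

lemma lin_eval_diff: "lin_eval f (x - y) = lin_eval f x - lin_eval f y"
  using lin_eval_add[of f x "- y"] by (simp add: lin_eval_uminus)

lemma lin_eval_0 [simp]: "lin_eval f 0 = 0"
  by (simp add: lin_eval_def)

lemma lin_eval_sum: "lin_eval f (\<Sum>i\<in>I. x i) = (\<Sum>i\<in>I. lin_eval f (x i))"
  by (induction I rule: infinite_finite_induct) (simp_all add: lin_eval_add)

lemma lin_eval_single [simp]: "lin_eval f (Poly_Mapping.single u c) = scalar_q c * f u"
  by (cases "c = 0") (simp_all add: lin_eval_def)

lemma lin_eval_word [simp]: "lin_eval f (word u) = f u"
  by (simp add: word_def)

lemma lin_eval_one [simp]: "lin_eval f 1 = f []"
  by (metis lin_eval_word word_def single_one zero_list_def)

lemma lin_eval_cong: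
  "x \<in> over S \<Longrightarrow> (\<And>u. u \<in> S \<Longrightarrow> f u = g u) \<Longrightarrow> lin_eval f x = lin_eval g x"
  unfolding lin_eval_def over_def by (intro sum.cong) auto

lemma ncpoly_eq_sum_single:
  "(x :: ncpoly) = (\<Sum>u\<in>Poly_Mapping.keys x. Poly_Mapping.single u (Poly_Mapping.lookup x u))"
  by (rule poly_mapping_eqI) (simp add: lookup_sum lookup_single when_def in_keys_iff)

text \<open>Left multiplication by a word becomes a shift of the functional, so the recursions of
  the products turn into recursions for sums.\<close>

lemma lin_eval_single_mult:
  "lin_eval f (Poly_Mapping.single v c * x) = scalar_q c * lin_eval (\<lambda>u. f (v @ u)) x"
proof -
  have "Poly_Mapping.single v c * x =
      (\<Sum>u\<in>Poly_Mapping.keys x. Poly_Mapping.single (v @ u) (c * Poly_Mapping.lookup x u))"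
    by (subst ncpoly_eq_sum_single[of x])
       (simp add: sum_distrib_left mult_single plus_list_def)
  then show ?thesis
    by (simp add: lin_eval_sum scalar_q_mult lin_eval_def[of _ x] sum_distrib_left mult.assoc)
qed

lemma lin_eval_scalar_mult [simp]: "lin_eval f (scalar c * x) = scalar_q c * lin_eval f x"
  by (simp add: scalar_def lin_eval_single_mult)

lemma lin_eval_word_mult [simp]: "lin_eval f (word v * x) = lin_eval (\<lambda>u. f (v @ u)) x"
  by (simp add: word_def lin_eval_single_mult)

lemma lin_eval_lin_ext: "lin_eval f (lin_ext g x) = lin_eval (\<lambda>u. lin_eval f (g u)) x"
  by (simp add: lin_ext_def lin_eval_sum) (simp add: lin_eval_def[of _ x])

lemma lin_eval_bilin_ext:
  "lin_eval f (bilin_ext g x y) = lin_eval (\<lambda>u. lin_eval (\<lambda>v. lin_eval f (g u v)) y) x"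
  by (simp add: bilin_ext_def lin_eval_lin_ext)

lemma lin_eval_cmult: "lin_eval (\<lambda>u. c * f u) x = c * lin_eval f x"
  by (simp add: lin_eval_def sum_distrib_left mult.left_commute)

lemma lin_eval_cmult_right: "lin_eval (\<lambda>u. f u * c) x = lin_eval f x * c"
  by (simp add: lin_eval_def sum_distrib_right mult.assoc)

lemma lin_eval_fun_add: "lin_eval (\<lambda>u. f u + g u) x = lin_eval f x + lin_eval g x"
  by (simp add: lin_eval_def sum.distrib distrib_left)

lemma lin_eval_fun_uminus: "lin_eval (\<lambda>u. - f u) x = - lin_eval f x"
  by (simp add: lin_eval_def sum_negf)

lemma lin_eval_fun_sum: "lin_eval (\<lambda>u. \<Sum>i\<in>I. f i u) x = (\<Sum>i\<in>I. lin_eval (f i) x)"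
  unfolding lin_eval_def by (subst sum.swap) (simp add: sum_distrib_left)

lemma zeta_q_eq_lin_eval: "zeta_q = lin_eval zeta_q_word"
  by (simp add: fun_eq_iff zeta_q_def lin_eval_def)

section \<open>Finite multiple harmonic sums\<close>

lemma q_int_eq_sum: "q_int m = (\<Sum>i<m. fps_X ^ i)"
proof -
  have "1 - fps_X ^ m = (1 - fps_X :: rat fps) * (\<Sum>i<m. fps_X ^ i)"
    by (rule one_diff_power_eq)
  moreover have "(1 - fps_X :: rat fps) \<noteq> 0"
    by (metis fps_X_neq_one right_minus_eq)
  ultimately show ?thesis
    by (simp add: q_int_def)
qed

lemma q_int_0 [simp]: "q_int 0 = 0"
  and q_int_Suc: "q_int (Suc m) = q_int m + fps_X ^ m"
  by (simp_all add: q_int_eq_sum)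

lemma q_int_Suc_shift: "q_int (Suc m) = 1 + fps_X * q_int m"
  unfolding q_int_eq_sum by (subst sum.lessThan_Suc_shift) (simp add: sum_distrib_left)

lemma q_int_Suc_nth_0 [simp]: "fps_nth (q_int (Suc m)) 0 = 1"
  by (simp add: q_int_Suc_shift)

lemma q_int_Suc_neq_0 [simp]: "q_int (Suc m) \<noteq> 0"
  by (metis fps_zero_nth q_int_Suc_nth_0 zero_neq_one)

lemma q_int_inverse [simp]:
  "q_int (Suc m) * inverse (q_int (Suc m)) = 1" "inverse (q_int (Suc m)) * q_int (Suc m) = 1"
  by (simp_all add: inverse_mult_eq_1 inverse_mult_eq_1')

text \<open>Coefficient j of [m] is 1 exactly when j < m. This supplies infinitely many points
  -[N].\<close>

lemma inj_q_int: "inj q_int"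
proof (rule injI)
  have "fps_nth (q_int m) j = (if j < m then 1 else 0)" for m j
    by (induction m) (auto simp: q_int_Suc fps_X_power_nth)
  moreover fix m n assume "q_int m = q_int n"
  ultimately have "(j < m) = (j < n)" for j
    by (metis zero_neq_one)
  then show "m = n" by (meson linorder_neqE_nat less_irrefl)
qed

section \<open>Weights of a single summation index\<close>

definition q_wt :: "nat \<Rightarrow> nat \<Rightarrow> rat fps" where
  "q_wt k m = fps_X ^ ((k - 1) * m) * inverse (q_int m) ^ k"

definition q_frac :: "nat \<Rightarrow> rat fps" where
  "q_frac m = fps_X ^ m * inverse (q_int m)"

lemma q_wt_one: "q_wt 1 m = inverse (q_int m)"
  by (simp add: q_wt_def)

lemma q_wt_Suc: "k \<ge> 1 \<Longrightarrow> q_wt (Suc k) m = q_frac m * q_wt k m"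
  by (cases k) (simp_all add: q_wt_def q_frac_def power_add mult_ac)

lemma q_wt_add:
  assumes "i \<ge> 1" "j \<ge> 1"
  shows "q_wt (i + j) m = fps_X ^ m * (q_wt i m * q_wt j m)"
proof -
  have "(i + j - 1) * m = m + (i - 1) * m + (j - 1) * m"
    using assms by (cases i; cases j) (auto simp: algebra_simps)
  then show ?thesis
    by (simp add: q_wt_def power_add mult_ac)
qed

text \<open>Insert 1 = q^m + (1 - q)[m] at the index \<open>Suc m\<close>. This mirrors
  \<open>circ_plus_letter\<close> with hbar acting as 1 - q.\<close>

lemma q_wt_mult:
  assumes "i \<ge> 1" "j \<ge> 1"
  shows "q_wt i (Suc m) * q_wt j (Suc m) = q_wt (i + j) (Suc m) + (1 - fps_X) * q_wt (i + j - 1) (Suc m)"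
proof -
  obtain a b where ab: "i = Suc a" "j = Suc b"
    using assms by (metis Suc_le_D One_nat_def)
  define J where "J = inverse (q_int (Suc m))"
  have q: "1 = fps_X ^ Suc m + (1 - fps_X) * q_int (Suc m)"
    by (simp only: q_int_eq_sum flip: one_diff_power_eq) simp
  have J: "q_int (Suc m) * J = 1" by (simp add: J_def)
  have "q_wt i (Suc m) * q_wt j (Suc m) = fps_X ^ ((a + b) * Suc m) * J ^ (a + b) * J * J * 1"
    by (simp add: q_wt_def ab J_def power_add algebra_simps)
  also have "\<dots> = fps_X ^ ((a + b) * Suc m) * J ^ (a + b) * J * J * fps_X ^ Suc m
      + (1 - fps_X) * (fps_X ^ ((a + b) * Suc m) * J ^ (a + b) * J * (q_int (Suc m) * J))"
    by (subst q) (simp only: distrib_left mult_ac)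
  also have "\<dots> = q_wt (i + j) (Suc m) + (1 - fps_X) * q_wt (i + j - 1) (Suc m)"
    unfolding J by (simp add: q_wt_def ab J_def power_add algebra_simps)
  finally show ?thesis .
qed

text \<open>The truncation of \<open>zeta_q_word\<close> to M >= m_1 > ... > m_r >= 1.\<close>

fun strict_sum :: "nat list \<Rightarrow> nat \<Rightarrow> rat fps" where
  "strict_sum [] M = 1"
| "strict_sum (k # u) 0 = 0"
| "strict_sum (k # u) (Suc M) = strict_sum (k # u) M + q_wt k (Suc M) * strict_sum u M"

lemma strict_sum_Cons: "strict_sum (k # u) M = (\<Sum>a<M. q_wt k (Suc a) * strict_sum u a)"
  by (induction M) simp_all

text \<open>Passing from M to \<open>Suc M\<close> adds the terms in which the first factor, the
  second, or both use the index \<open>Suc M\<close>; in the last case \<open>q_wt_mult\<close>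
  merges the two weights.\<close>

lemma strict_sum_star_plus_word:
  assumes "0 \<notin> set u" "0 \<notin> set v"
  shows "lin_eval (\<lambda>w. strict_sum w M) (star_plus_word u v) = strict_sum u M * strict_sum v M"
  using assms
proof (induction u v arbitrary: M rule: star_plus_word.induct)
  case (3 i u j v)
  have pos: "i \<ge> 1" "j \<ge> 1" using 3 by auto
  show ?case
  proof (induction M)
    case 0
    show ?case by (simp add: lin_eval_add circ_plus_letter_def distrib_right mult.assoc lin_eval_cmult[of 0, simplified])
  next
    case (Suc M)
    have "lin_eval (\<lambda>w. strict_sum w (Suc M)) (star_plus_word (i # u) (j # v)) =
      lin_eval (\<lambda>w. strict_sum w M) (star_plus_word (i # u) (j # v))
      + q_wt i (Suc M) * (strict_sum u M * strict_sum (j # v) M)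
      + q_wt j (Suc M) * (strict_sum (i # u) M * strict_sum v M)
      + (q_wt (i + j) (Suc M) + (1 - fps_X) * q_wt (i + j - 1) (Suc M)) * (strict_sum u M * strict_sum v M)"
      using 3
      by (simp add: lin_eval_add circ_plus_letter_def distrib_right mult.assoc
          lin_eval_fun_add lin_eval_cmult distrib_left)
    also have "\<dots> = strict_sum (i # u) (Suc M) * strict_sum (j # v) (Suc M)"
      unfolding Suc q_wt_mult[OF pos, symmetric] by (simp add: algebra_simps)
    finally show ?case .
  qed
qed simp_all

text \<open>S_u(M) of the overview: the inner call stays at \<open>Suc M\<close>, which allows equal
  indices.\<close>

fun weak_sum :: "nat list \<Rightarrow> nat \<Rightarrow> rat fps" where
  "weak_sum [] M = 1"
| "weak_sum (k # u) 0 = 0"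
| "weak_sum (k # u) (Suc M) = weak_sum (k # u) M + q_frac (Suc M) ^ k * weak_sum u (Suc M)"

text \<open>For weak inequalities the first two terms both contain the case of equal largest
  indices, whence the minus sign in \<open>star_bar_word\<close>.\<close>

lemma weak_sum_star_bar_word:
  "lin_eval (\<lambda>w. weak_sum w M) (star_bar_word u v) = weak_sum u M * weak_sum v M"
proof (induction u v arbitrary: M rule: star_bar_word.induct)
  case (3 i u j v)
  show ?case
  proof (induction M)
    case 0
    show ?case by (simp add: lin_eval_add lin_eval_diff lin_eval_cmult[of 0, simplified])
  next
    case (Suc M)
    have "lin_eval (\<lambda>w. weak_sum w (Suc M)) (star_bar_word (i # u) (j # v)) =
      lin_eval (\<lambda>w. weak_sum w M) (star_bar_word (i # u) (j # v))
      + q_frac (Suc M) ^ i * (weak_sum u (Suc M) * weak_sum (j # v) (Suc M))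
      + q_frac (Suc M) ^ j * (weak_sum (i # u) (Suc M) * weak_sum v (Suc M))
      - q_frac (Suc M) ^ (i + j) * (weak_sum u (Suc M) * weak_sum v (Suc M))"
      by (simp add: lin_eval_add lin_eval_diff lin_eval_fun_add lin_eval_cmult 3 del: weak_sum.simps(3))
         (simp add: lin_eval_fun_add lin_eval_cmult 3)
    also have "\<dots> = weak_sum (i # u) (Suc M) * weak_sum (j # v) (Suc M)"
      unfolding Suc by (simp add: algebra_simps power_add)
    finally show ?case .
  qed
qed simp_all

lemma weak_sum_star_bar:
  "lin_eval (\<lambda>w. weak_sum w M) (star_bar x y)
    = lin_eval (\<lambda>w. weak_sum w M) x * lin_eval (\<lambda>w. weak_sum w M) y"
  by (simp add: star_bar_def lin_eval_bilin_ext weak_sum_star_bar_word lin_eval_cmult lin_eval_cmult_right)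

text \<open>The summands are indexed by \<open>m = m\<^sub>1 - 1\<close>.\<close>

fun strict_term :: "nat list \<Rightarrow> nat \<Rightarrow> rat fps" where
  "strict_term [] m = 0"
| "strict_term (k # u) m = q_wt k (Suc m) * strict_sum u m"

text \<open>The part of the nested sum of d(u) with largest index \<open>Suc m\<close>.\<close>

definition d_term :: "nat list \<Rightarrow> nat \<Rightarrow> rat fps" where
  "d_term u m = lin_eval (\<lambda>w. strict_term w m) (d_word u)"

lemma strict_sum_eq_sum_strict_term: "u \<noteq> [] \<Longrightarrow> strict_sum u M = (\<Sum>a<M. strict_term u a)"
  by (cases u) (simp_all add: strict_sum_Cons)

lemma d_term_singleton: "d_term [k] m = q_wt k (Suc m)"
  by (simp add: d_term_def lin_eval_add circ_act_def lin_eval_lin_ext)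

text \<open>In z_k d(u) the largest index of d(u) lies strictly below \<open>Suc m\<close>; in the
  circ term k is absorbed by the first letter, so that index equals \<open>Suc m\<close>, and
  \<open>q_wt_add\<close> supplies the extra q^(m+1).\<close>

lemma d_term_Cons:
  assumes "u \<noteq> []" "0 \<notin> set u" "k \<ge> 1"
  shows "d_term (k # u) m = q_wt k (Suc m) * (fps_X ^ Suc m * d_term u m + (\<Sum>a<m. d_term u a))"
proof -
  have over: "d_word u \<in> over {u. u \<noteq> [] \<and> 0 \<notin> set u}"
    using d_word_h1[of u] assms by (simp add: carriers_over)
  have "lin_eval (\<lambda>v. strict_sum v m) (d_word u) = (\<Sum>a<m. d_term u a)"
    unfolding d_term_def lin_eval_fun_sum[symmetric]
    by (rule lin_eval_cong[OF over]) (simp add: strict_sum_eq_sum_strict_term)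
  moreover have "lin_eval (\<lambda>v. lin_eval (\<lambda>w. strict_term w m) (circ_word k v)) (d_word u) =
      q_wt k (Suc m) * fps_X ^ Suc m * d_term u m"
    unfolding d_term_def lin_eval_cmult[symmetric]
  proof (rule lin_eval_cong[OF over])
    fix v :: "nat list" assume v: "v \<in> {u. u \<noteq> [] \<and> 0 \<notin> set u}"
    then obtain j v' where "v = j # v'" "j \<ge> 1"
      by (cases v) auto
    then show "lin_eval (\<lambda>w. strict_term w m) (circ_word k v) = q_wt k (Suc m) * fps_X ^ Suc m * strict_term v m"
      using assms(3) by (simp add: circ_letter_def q_wt_add mult_ac)
  qed
  ultimately show ?thesis
    by (simp add: d_term_def[of "k # u"] lin_eval_add circ_act_def lin_eval_lin_ext lin_eval_cmult
        distrib_left mult.assoc)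
qed

section \<open>The dual composition\<close>

definition consecutive_diffs :: "nat list \<Rightarrow> nat list" where
  "consecutive_diffs p = map2 (\<lambda>a b. a - b) p (0 # butlast p)"

definition dual_points :: "nat list \<Rightarrow> nat set" where
  "dual_points u = {1..sum_list u} - partial_sums u"

lemma phi_list_eq: "phi_list u = consecutive_diffs (sorted_list_of_set (dual_points u))"
  by (simp add: phi_list_def consecutive_diffs_def dual_points_def Let_def)

lemma finite_dual_points [simp]: "finite (dual_points u)"
  by (simp add: dual_points_def)

lemma map_Suc_diffs: "map2 (\<lambda>a b. a - b) (map Suc p) (map Suc q) = map2 (\<lambda>a b. a - b) p q"
  by (simp add: zip_map_map case_prod_unfold)

lemma consecutive_diffs_map_Suc:
  assumes "p \<noteq> []"
  shows "consecutive_diffs (map Suc p) = Suc (hd (consecutive_diffs p)) # tl (consecutive_diffs p)"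
    and "consecutive_diffs (1 # map Suc p) = 1 # consecutive_diffs p"
proof -
  obtain a r where p: "p = a # r" using assms by (cases p) auto
  have b: "butlast (map Suc p) = map Suc (butlast p)"
    by (simp add: map_butlast)
  show "consecutive_diffs (map Suc p) = Suc (hd (consecutive_diffs p)) # tl (consecutive_diffs p)"
    using map_Suc_diffs[of r "butlast p"] b unfolding p consecutive_diffs_def by simp
  have "1 # map Suc (butlast p) = map Suc (0 # butlast p)" by simp
  then show "consecutive_diffs (1 # map Suc p) = 1 # consecutive_diffs p"
    using map_Suc_diffs[of p "0 # butlast p"] b unfolding consecutive_diffs_def
    using p by simp
qed

lemma partial_sums_eq_image: "partial_sums u = (\<lambda>j. sum_list (take j u)) ` {1..<length u}"
  unfolding partial_sums_def by (auto simp: image_iff)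

lemma partial_sums_Cons:
  "partial_sums (k # v) = (if v = [] then {} else insert k ((+) k ` partial_sums v))"
proof (cases "v = []")
  case False
  have "partial_sums (k # v) = (\<lambda>j. sum_list (take j (k # v))) ` Suc ` {..<length v}"
    by (simp only: partial_sums_eq_image image_Suc_lessThan) (simp add: atLeastLessThanSuc_atLeastAtMost)
  also have "{..<length v} = insert 0 {1..<length v}"
    using False by (cases v) auto
  also have "(\<lambda>j. sum_list (take j (k # v))) ` Suc ` insert 0 {1..<length v} =
      insert k ((+) k ` partial_sums v)"
    by (simp add: partial_sums_eq_image image_image del: image_Suc_atLeastLessThan)
  finally show ?thesis using False by simp
qed (simp add: partial_sums_def)

text \<open>The first partial sum is 1, so 1 is removed and the other points move up by one.\<close>

lemma dual_points_one_Cons: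
  assumes "v \<noteq> []"
  shows "dual_points (1 # v) = Suc ` dual_points v"
proof -
  have "{1..sum_list (1 # v)} = insert 1 (Suc ` {1..sum_list v})"
    unfolding image_Suc_atLeastAtMost by auto
  then show ?thesis using assms
    unfolding dual_points_def
    by (simp add: partial_sums_Cons image_set_diff del: image_Suc_atLeastAtMost) auto
qed

text \<open>All partial sums exceed 1, so 1 becomes a dual point and the old points move up by
  one.\<close>

lemma dual_points_Suc_Cons:
  assumes "k \<ge> 1"
  shows "dual_points (Suc k # v) = insert 1 (Suc ` dual_points (k # v))"
proof -
  have 1: "{1..sum_list (Suc k # v)} = insert 1 (Suc ` {1..sum_list (k # v)})"
    unfolding image_Suc_atLeastAtMost by auto
  have 2: "partial_sums (Suc k # v) = Suc ` partial_sums (k # v)"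
    by (auto simp: partial_sums_Cons image_image)
  have 3: "1 \<notin> Suc ` partial_sums (k # v)"
    using assms by (auto simp: partial_sums_Cons split: if_splits)
  show ?thesis unfolding dual_points_def 1 2 image_set_diff[OF inj_Suc] using 3
    by (simp add: insert_Diff_if del: image_Suc_atLeastAtMost)
qed

lemma sorted_list_of_set_Suc:
  assumes "finite A"
  shows "sorted_list_of_set (Suc ` A) = map Suc (sorted_list_of_set A)"
proof -
  have "sorted_wrt (<) (map Suc (sorted_list_of_set A))"
    by (simp add: sorted_wrt_map)
  then show ?thesis
    using assms by (metis list.set_map set_sorted_list_of_set sorted_list_of_set.idem_if_sorted_distinct strict_sorted_iff)
qed

lemma sorted_list_of_set_one_Suc:
  assumes "finite A" "0 \<notin> A"
  shows "sorted_list_of_set (insert 1 (Suc ` A)) = 1 # map Suc (sorted_list_of_set A)"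
proof -
  let ?l = "1 # map Suc (sorted_list_of_set A)"
  have "sorted_wrt (<) ?l"
    using assms by (auto simp: sorted_wrt_map intro: gr0I)
  moreover have "set ?l = insert 1 (Suc ` A)"
    using assms by simp
  ultimately show ?thesis
    by (metis sorted_list_of_set.idem_if_sorted_distinct strict_sorted_iff)
qed

lemma dual_points_nonempty:
  assumes "u \<noteq> []" "0 \<notin> set u"
  shows "sorted_list_of_set (dual_points u) \<noteq> []"
  using phi_list_pos[OF assms] by (auto simp: phi_list_eq consecutive_diffs_def)

lemma phi_list_one: "phi_list [1] = [1]"
  by (simp add: phi_list_def partial_sums_def)

text \<open>Together with \<open>phi_list_one\<close> and \<open>phi_list_Suc_Cons\<close> this
  determines phi by induction on the weight: prepending z_1 on one side means raising the first
  index on the other.\<close>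

lemma phi_list_one_Cons:
  assumes "v \<noteq> []" "0 \<notin> set v"
  shows "phi_list (1 # v) = Suc (hd (phi_list v)) # tl (phi_list v)"
  using assms dual_points_nonempty[OF assms]
  by (simp add: phi_list_eq dual_points_one_Cons[unfolded One_nat_def] sorted_list_of_set_Suc consecutive_diffs_map_Suc)

lemma phi_list_Suc_Cons:
  assumes "k \<ge> 1" "0 \<notin> set v"
  shows "phi_list (Suc k # v) = 1 # phi_list (k # v)"
proof -
  have "0 \<notin> dual_points (k # v)" by (simp add: dual_points_def)
  then show ?thesis
    using assms dual_points_nonempty[of "k # v"]
    unfolding phi_list_eq dual_points_Suc_Cons[OF assms(1)]
    by (simp only: sorted_list_of_set_one_Suc finite_dual_points not_False_eq_True)
       (rule consecutive_diffs_map_Suc(2), simp)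
qed

section \<open>The \<open>q\<close>-Newton transform\<close>

text \<open>
  The value at \<open>t = -[N]\<close> of \<open>t/[m] \<cdot> \<Prod>\<^bsub>j<m\<^esub> (1 + t/[j])\<close>, that is,
  \<open>(-1)\<^sup>m\<close> times \<open>q\<^bsup>m(m-1)/2\<^esup>\<close> times the \<open>q\<close>-binomial coefficient of \<open>N\<close> over \<open>m\<close>.
\<close>

fun q_newton :: "nat \<Rightarrow> nat \<Rightarrow> rat fps" where
  "q_newton 0 N = 1"
| "q_newton (Suc m) N = (q_int m - q_int N) * inverse (q_int (Suc m)) * q_newton m N"

lemma q_newton_Suc: "q_int (Suc m) * q_newton (Suc m) N = (q_int m - q_int N) * q_newton m N"
  using q_int_inverse(1)[of m] by (simp add: mult.assoc[symmetric] mult.commute[of _ "inverse _"])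

lemma q_newton_eq_0: "m > N \<Longrightarrow> q_newton m N = 0"
proof (induction m)
  case (Suc m)
  then show ?case by (cases "m = N") auto
qed simp

text \<open>The q-Pascal rule for signed q-binomials, written so that the right side is a difference
  of consecutive values of q^m \<open>q_newton m N\<close>.\<close>

lemma q_newton_pascal:
  "q_newton (Suc m) (Suc N) = fps_X ^ Suc m * q_newton (Suc m) N - fps_X ^ m * q_newton m N"
proof (induction m)
  case 0
  show ?case by (simp add: q_int_Suc_shift algebra_simps)
next
  case (Suc m)
  define Q where "Q = q_newton (Suc m) N"
  have pred: "(q_int m - q_int N) * q_newton m N = q_int (Suc m) * Q"
    by (simp only: q_newton_Suc Q_def)
  have diff: "q_int (Suc m) - q_int (Suc N) = fps_X * (q_int m - q_int N)"
    by (simp add: q_int_Suc_shift algebra_simps)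
  have "q_int (Suc (Suc m)) * q_newton (Suc (Suc m)) (Suc N)
      = (q_int (Suc m) - q_int (Suc N)) * (fps_X ^ Suc m * Q - fps_X ^ m * q_newton m N)"
    unfolding q_newton_Suc Suc Q_def ..
  also have "\<dots> = fps_X ^ Suc m * ((q_int (Suc m) - q_int (Suc N)) * Q - (q_int m - q_int N) * q_newton m N)"
    unfolding diff by (simp add: algebra_simps)
  also have "\<dots> = - (fps_X ^ Suc m * q_int (Suc N) * Q)"
    unfolding pred by (simp add: algebra_simps)
  also have "\<dots> = fps_X ^ Suc (Suc m) * ((q_int (Suc m) - q_int N) * Q) - fps_X ^ Suc m * (q_int (Suc (Suc m)) * Q)"
    by (simp add: q_int_Suc_shift algebra_simps)
  also have "\<dots> = q_int (Suc (Suc m)) *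
      (fps_X ^ Suc (Suc m) * q_newton (Suc (Suc m)) N - fps_X ^ Suc m * q_newton (Suc m) N)"
    unfolding Q_def q_newton_Suc[symmetric] by (simp add: right_diff_distrib mult.left_commute del: q_newton.simps)
  finally show ?case
    by (simp only: mult_left_cancel q_int_Suc_neq_0 not_False_eq_True)
qed

text \<open>For m <= N + 1 this is the usual ratio of the q-binomials for N and N + 1, with q^m
  [N+1-m] = [N+1] - [m]; for larger m both sides vanish.\<close>

lemma q_newton_pred:
  "fps_X ^ m * q_int (Suc N) * q_newton m N = (q_int (Suc N) - q_int m) * q_newton m (Suc N)"
proof (induction m)
  case (Suc m)
  have diff: "q_int (Suc m) - q_int (Suc N) = fps_X * (q_int m - q_int N)"
    by (simp add: q_int_Suc_shift algebra_simps)
  have "q_int (Suc m) * (fps_X ^ Suc m * q_int (Suc N) * q_newton (Suc m) N)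
      = fps_X ^ Suc m * q_int (Suc N) * (q_int (Suc m) * q_newton (Suc m) N)"
    by (simp only: mult_ac)
  also have "\<dots> = (q_int (Suc m) - q_int (Suc N)) * (fps_X ^ m * q_int (Suc N) * q_newton m N)"
    unfolding q_newton_Suc diff by (simp add: mult_ac)
  also have "\<dots> = (q_int (Suc N) - q_int (Suc m)) * ((q_int m - q_int (Suc N)) * q_newton m (Suc N))"
    unfolding Suc by (simp add: algebra_simps)
  also have "\<dots> = q_int (Suc m) * ((q_int (Suc N) - q_int (Suc m)) * q_newton (Suc m) (Suc N))"
    unfolding q_newton_Suc[symmetric] by (simp only: mult_ac)
  finally show ?case
    by (simp only: mult_left_cancel q_int_Suc_neq_0 not_False_eq_True)
qed simp

text \<open>By \<open>q_newton_pred\<close> this reduces to the symmetry in a and b of q^a [b] + [a]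
  = [a+b]. It trades q^m/[m] for q^N/[N].\<close>

lemma q_newton_diff:
  "(q_newton (Suc m) (Suc N) - q_newton (Suc m) N) * q_frac (Suc m) = q_frac (Suc N) * q_newton (Suc m) (Suc N)"
proof -
  define P where "P = q_newton (Suc m) (Suc N)"
  define P' where "P' = q_newton (Suc m) N"
  have add: "fps_X ^ Suc m * q_int (Suc N) + q_int (Suc m) = fps_X ^ Suc N * q_int (Suc m) + q_int (Suc N)"
  proof -
    have "fps_X ^ a * q_int b + q_int a = q_int (a + b)" for a b
      by (induction b) (simp_all add: q_int_Suc algebra_simps power_add)
    then show ?thesis by (metis add.commute)
  qed
  have "fps_X ^ Suc m * q_int (Suc N) * (P - P') =
      fps_X ^ Suc m * q_int (Suc N) * P - (q_int (Suc N) - q_int (Suc m)) * P"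
    unfolding P_def P'_def q_newton_pred[symmetric] by (simp only: right_diff_distrib)
  also have "\<dots> = (fps_X ^ Suc m * q_int (Suc N) + q_int (Suc m) - q_int (Suc N)) * P"
    by (simp add: algebra_simps)
  also have "\<dots> = fps_X ^ Suc N * q_int (Suc m) * P"
    unfolding add by simp
  finally have *: "fps_X ^ Suc m * q_int (Suc N) * (P - P') = fps_X ^ Suc N * q_int (Suc m) * P" .
  have "(P - P') * q_frac (Suc m) =
      (q_int (Suc N) * inverse (q_int (Suc N))) * ((P - P') * q_frac (Suc m))"
    by simp
  also have "\<dots> = (fps_X ^ Suc m * q_int (Suc N) * (P - P')) * inverse (q_int (Suc m)) * inverse (q_int (Suc N))"
    unfolding q_frac_def by (simp only: mult_ac)
  also have "\<dots> = (q_int (Suc m) * inverse (q_int (Suc m))) * (q_frac (Suc N) * P)"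
    unfolding * unfolding q_frac_def by (simp only: mult_ac)
  finally show ?thesis by (simp add: P_def P'_def)
qed

text \<open>The shift by one matches \<open>strict_term\<close>. Since
  \<open>q_newton (Suc a) N\<close> is 0 for a >= N, nothing is cut off.\<close>

definition q_newton_sum :: "(nat \<Rightarrow> rat fps) \<Rightarrow> nat \<Rightarrow> rat fps" where
  "q_newton_sum b N = (\<Sum>a<N. q_newton (Suc a) N * b a)"

lemma q_newton_sum_extend: "N \<le> K \<Longrightarrow> q_newton_sum b N = (\<Sum>a<K. q_newton (Suc a) N * b a)"
  unfolding q_newton_sum_def
  by (rule sum.mono_neutral_left) (auto simp: q_newton_eq_0 simp del: q_newton.simps)

lemma q_newton_sum_eq_Suc: "q_newton_sum b N = (\<Sum>a<Suc N. q_newton (Suc a) N * b a)"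
  by (rule q_newton_sum_extend) simp

lemma q_newton_sum_0 [simp]: "q_newton_sum b 0 = 0"
  by (simp add: q_newton_sum_def)

lemma q_newton_sum_diff:
  "q_newton_sum b (Suc N) - q_newton_sum b N
    = (\<Sum>a<Suc N. (q_newton (Suc a) (Suc N) - q_newton (Suc a) N) * b a)"
  by (simp only: q_newton_sum_def[of b "Suc N"] q_newton_sum_eq_Suc[of b N]
      left_diff_distrib sum_subtractf)

text \<open>Sum \<open>q_newton_diff\<close> against b: weighting the coefficients by q^m/[m]
  becomes summation over N with weight q^N/[N].\<close>

lemma q_newton_sum_q_frac:
  "q_newton_sum (\<lambda>a. q_frac (Suc a) * b a) (Suc N)
    = q_newton_sum (\<lambda>a. q_frac (Suc a) * b a) N + q_frac (Suc N) * q_newton_sum b (Suc N)"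
proof -
  have "q_newton_sum (\<lambda>a. q_frac (Suc a) * b a) (Suc N) - q_newton_sum (\<lambda>a. q_frac (Suc a) * b a) N
      = (\<Sum>a<Suc N. (q_newton (Suc a) (Suc N) - q_newton (Suc a) N) * q_frac (Suc a) * b a)"
    by (simp only: q_newton_sum_diff mult.assoc)
  also have "\<dots> = q_frac (Suc N) * q_newton_sum b (Suc N)"
    by (simp only: q_newton_diff q_newton_sum_def sum_distrib_left mult.assoc)
  finally show ?thesis by (simp add: algebra_simps)
qed

text \<open>By \<open>q_newton_pascal\<close> the sum telescopes, and its upper end contains
  \<open>q_newton (Suc N) N\<close>, which is 0.\<close>

lemma q_newton_tail_sum:
  assumes "m \<le> N"
  shows "(\<Sum>a\<in>{m..N}. q_newton (Suc a) (Suc N)) = - (fps_X ^ m * q_newton m N)"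
proof -
  have tel: "q_newton (Suc a) (Suc N) = fps_X ^ Suc a * q_newton (Suc a) N - fps_X ^ a * q_newton a N" for a
    by (rule q_newton_pascal)
  have "(\<Sum>a\<in>{m..N}. q_newton (Suc a) (Suc N)) =
      fps_X ^ Suc N * q_newton (Suc N) N - fps_X ^ m * q_newton m N"
    unfolding tel by (rule sum_Suc_diff) (use assms in simp)
  then show ?thesis by (simp add: q_newton_eq_0 del: q_newton.simps)
qed

lemma q_newton_sum_one: "q_newton_sum (\<lambda>_. 1) (Suc N) = - 1"
  using q_newton_tail_sum[of 0 N]
  by (simp add: q_newton_sum_def lessThan_Suc_atMost atMost_atLeast0 del: q_newton.simps(2))

text \<open>Exchanging the sums pairs each c(i) with a tail sum of Newton coefficients, which gives
  minus the transform at N. The coefficients have the shape of the bracket in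
  \<open>d_term_Cons\<close>.\<close>

lemma q_newton_sum_partial_sums:
  "q_newton_sum (\<lambda>a. fps_X ^ Suc a * c a + (\<Sum>i<a. c i)) (Suc N)
    = q_newton_sum (\<lambda>a. fps_X ^ Suc a * c a) (Suc N) - q_newton_sum (\<lambda>a. fps_X ^ Suc a * c a) N"
proof -
  have "(\<Sum>a<Suc N. q_newton (Suc a) (Suc N) * (\<Sum>i<a. c i))
      = (\<Sum>a<Suc N. \<Sum>i<a. q_newton (Suc a) (Suc N) * c i)"
    by (simp only: sum_distrib_left)
  also have "\<dots> = (\<Sum>i<N. \<Sum>a\<in>{Suc i..N}. q_newton (Suc a) (Suc N) * c i)"
    unfolding lessThan_Suc_atMost by (rule sum.nested_swap')
  also have "\<dots> = (\<Sum>i<N. - (q_newton (Suc i) N * (fps_X ^ Suc i * c i)))"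
  proof (rule sum.cong[OF refl])
    fix i assume "i \<in> {..<N}"
    then have "(\<Sum>a\<in>{Suc i..N}. q_newton (Suc a) (Suc N)) = - (fps_X ^ Suc i * q_newton (Suc i) N)"
      by (intro q_newton_tail_sum) simp
    then show "(\<Sum>a\<in>{Suc i..N}. q_newton (Suc a) (Suc N) * c i)
        = - (q_newton (Suc i) N * (fps_X ^ Suc i * c i))"
      unfolding sum_distrib_right[symmetric] by (simp add: mult_ac del: q_newton.simps)
  qed
  also have "\<dots> = - q_newton_sum (\<lambda>a. fps_X ^ Suc a * c a) N"
    by (simp only: sum_negf q_newton_sum_def)
  finally show ?thesis
    by (simp only: q_newton_sum_def[of _ "Suc N"] distrib_left sum.distrib) simp
qed

text \<open>Duality: the \<open>q\<close>-Newton transform exchanges the two ways of joining letters, as \<open>phi_list\<close> does.\<close>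

lemma q_newton_sum_dual:
  assumes "u \<noteq> []" "0 \<notin> set u"
  shows "q_newton_sum (\<lambda>a. fps_X ^ Suc a * d_term (phi_list u) a) N = - weak_sum u N"
  using assms
proof (induction "sum_list u" arbitrary: u N rule: less_induct)
  case less
  then obtain k v where u: "u = k # v" "k \<ge> 1" "0 \<notin> set v"
    by (cases u) auto
  let ?b = "\<lambda>u a. fps_X ^ Suc a * d_term (phi_list u) a"
  \<comment> \<open>A nonempty composition is \<open>[1]\<close>, or a smaller one with 1 prepended,
    or a smaller one with its first entry raised; the dual of the smaller one is then raised or
    extended, respectively.\<close>
  consider "k = 1" "v = []" | "k = 1" "v \<noteq> []" | k' where "k = Suc k'" "k' \<ge> 1"
    using u(2) by (metis One_nat_def Suc_le_D not_less_eq_eq le_antisym One_nat_def)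
  then show ?case
  proof cases
    case 1
    have eq: "?b u = (\<lambda>a. q_frac (Suc a) * 1)"
      using u 1 phi_list_one by (simp add: d_term_singleton fun_eq_iff q_wt_one[unfolded One_nat_def] q_frac_def)
    show ?thesis
    proof (induction N)
      case (Suc N)
      show ?case
        using Suc unfolding eq q_newton_sum_q_frac q_newton_sum_one by (simp add: u 1)
    qed (simp add: u)
  next
    case 2
    have "phi_list v \<noteq> [] \<and> 0 \<notin> set (phi_list v)"
      using 2 u by (intro phi_list_pos) auto
    then obtain j w where jw: "phi_list v = j # w" "j \<ge> 1" "0 \<notin> set w"
      by (cases "phi_list v") auto
    have "phi_list u = Suc j # w"
      using phi_list_one_Cons[of v] u 2 jw by simp
    moreover have "d_term (Suc j # w) a = q_frac (Suc a) * d_term (j # w) a" for a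
      using jw by (cases "w = []") (simp_all add: d_term_singleton d_term_Cons q_wt_Suc mult.assoc)
    ultimately have eq: "?b u = (\<lambda>a. q_frac (Suc a) * ?b v a)"
      using jw by (simp add: fun_eq_iff mult_ac)
    have IH: "q_newton_sum (?b v) N = - weak_sum v N" for N
      using u 2 by (intro less.hyps) auto
    show ?thesis
    proof (induction N)
      case (Suc N)
      show ?case
        using Suc unfolding eq q_newton_sum_q_frac IH by (simp add: u 2)
    qed (simp add: u)
  next
    case 3
    let ?u = "k' # v"
    have phi: "phi_list u = 1 # phi_list ?u"
      using u 3 phi_list_Suc_Cons by simp
    have pos: "phi_list ?u \<noteq> []" "0 \<notin> set (phi_list ?u)"
      using phi_list_pos[of ?u] 3 u by auto
    let ?c = "d_term (phi_list ?u)"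
    have eq: "?b u = (\<lambda>a. q_frac (Suc a) * (fps_X ^ Suc a * ?c a + (\<Sum>i<a. ?c i)))"
      unfolding phi using pos
      by (simp add: fun_eq_iff d_term_Cons q_wt_one[unfolded One_nat_def] q_frac_def mult_ac)
    have IH: "q_newton_sum (?b ?u) N = - weak_sum ?u N" for N
      using u 3 by (intro less.hyps) auto
    \<comment> \<open>The values of \<open>weak_sum ?u\<close> at \<open>Suc N\<close> and N differ
      by \<open>q_frac (Suc N) ^ k' * weak_sum v (Suc N)\<close>; one more factor
      \<open>q_frac (Suc N)\<close> gives the increment for u.\<close>
    show ?thesis
    proof (induction N)
      case (Suc N)
      show ?case
        using Suc unfolding eq q_newton_sum_q_frac q_newton_sum_partial_sums IH
        by (simp add: u 3 algebra_simps)
    qed (simp add: u)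
  qed
qed

section \<open>Evaluation of the zeta values\<close>

definition decreasing_tuples :: "nat \<Rightarrow> nat \<Rightarrow> nat list set" where
  "decreasing_tuples r M = {m. length m = r \<and> sorted_wrt (>) m \<and> set m \<subseteq> {1..M}}"

lemma finite_decreasing_tuples: "finite (decreasing_tuples r M)"
  by (rule finite_subset[OF _ finite_lists_length_eq[of "{1..M}" r]]) (auto simp: decreasing_tuples_def)

lemma decreasing_tuples_Suc:
  "decreasing_tuples (Suc r) (Suc M) =
     decreasing_tuples (Suc r) M \<union> (#) (Suc M) ` decreasing_tuples r M"
proof (intro equalityI subsetI)
  fix m assume m: "m \<in> decreasing_tuples (Suc r) (Suc M)"
  then obtain a m' where am: "m = a # m'" by (cases m) (auto simp: decreasing_tuples_def)
  show "m \<in> decreasing_tuples (Suc r) M \<union> (#) (Suc M) ` decreasing_tuples r M"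
  proof (cases "a = Suc M")
    case True
    then show ?thesis using m am by (fastforce simp: decreasing_tuples_def)
  next
    case False
    then show ?thesis using m am by (fastforce simp: decreasing_tuples_def)
  qed
qed (fastforce simp: decreasing_tuples_def)+

lemma strict_sum_eq_sum_tuples:
  "(\<Sum>m\<in>decreasing_tuples (length u) M. prod_list (map2 q_wt u m)) = strict_sum u M"
proof (induction u M rule: strict_sum.induct)
  case (1 M)
  have "decreasing_tuples 0 M = {[]}" by (auto simp: decreasing_tuples_def)
  then show ?case by simp
next
  case (2 k u)
  have "decreasing_tuples (Suc (length u)) 0 = {}" by (auto simp: decreasing_tuples_def)
  then show ?case by simp
next
  case (3 k u M)
  have "decreasing_tuples (Suc (length u)) M \<inter> (#) (Suc M) ` decreasing_tuples (length u) M = {}"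
    by (auto simp: decreasing_tuples_def)
  then have "(\<Sum>m\<in>decreasing_tuples (length (k # u)) (Suc M). prod_list (map2 q_wt (k # u) m))
      = (\<Sum>m\<in>decreasing_tuples (length (k # u)) M. prod_list (map2 q_wt (k # u) m))
      + (\<Sum>m\<in>(#) (Suc M) ` decreasing_tuples (length u) M. prod_list (map2 q_wt (k # u) m))"
    unfolding list.size add_Suc_right add_0_right decreasing_tuples_Suc
    by (intro sum.union_disjoint) (auto intro: finite_decreasing_tuples)
  also have "(\<Sum>m\<in>(#) (Suc M) ` decreasing_tuples (length u) M. prod_list (map2 q_wt (k # u) m))
      = q_wt k (Suc M) * (\<Sum>m\<in>decreasing_tuples (length u) M. prod_list (map2 q_wt u m))"
    by (subst sum.reindex) (auto simp: sum_distrib_left)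
  finally show ?case using 3 by simp
qed

lemma zeta_summand_eq:
  assumes "length k = length m" "0 \<notin> set m"
  shows "fps_X ^ (\<Sum>j<length k. (k ! j - 1) * m ! j) / (\<Prod>j<length k. q_int (m ! j) ^ (k ! j))
    = prod_list (map2 q_wt k m)"
proof -
  \<comment> \<open>The nonzero constant term of the denominator is carried along so that division
    becomes multiplication by the inverse.\<close>
  have "fps_nth (\<Prod>j<length k. q_int (m ! j) ^ (k ! j)) 0 \<noteq> 0 \<and>
    fps_X ^ (\<Sum>j<length k. (k ! j - 1) * m ! j) * inverse (\<Prod>j<length k. q_int (m ! j) ^ (k ! j))
      = prod_list (map2 q_wt k m)"
    using assms
  proof (induction k m rule: list_induct2)
    case (Cons i k a m)
    then obtain b where a: "a = Suc b" by (cases a) auto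
    have ih: "prod_list (map2 q_wt k m) = fps_X ^ (\<Sum>j<length k. (k ! j - 1) * m ! j) * inverse (\<Prod>j<length k. q_int (m ! j) ^ (k ! j))"
      using Cons by simp
    show ?case
      using Cons(2,3)
      by (simp add: sum.lessThan_Suc_shift prod.lessThan_Suc_shift ih q_wt_def fps_inverse_mult fps_inverse_power
          power_add a fps_mult_nth_0 fps_power_zeroth mult_ac del: sum.lessThan_Suc prod.lessThan_Suc)
  qed simp
  then show ?thesis by (simp add: fps_divide_unit)
qed

text \<open>As k >= 2, the summand is divisible by q^(m_1), so only finitely many tuples affect a
  given coefficient.\<close>

lemma zeta_q_word_Cons:
  assumes "k \<ge> 2"
  shows "zeta_q_word (k # u) = psum (\<lambda>a. q_wt k (Suc a) * strict_sum u a)"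
proof -
  define f where "f m = fps_X ^ (\<Sum>j<length (k # u). ((k # u) ! j - 1) * m ! j)
    / (\<Prod>j<length (k # u). q_int (m ! j) ^ ((k # u) ! j))" for m
  let ?A = "{m. length m = length (k # u) \<and> sorted_wrt (>) m \<and> 0 \<notin> set m}"
  \<comment> \<open>The bound is \<open>Suc j\<close> since the cutoff a <= j in \<open>psum\<close>
    belongs to m_1 = \<open>Suc a\<close>.\<close>
  let ?F = "\<lambda>j. decreasing_tuples (length (k # u)) (Suc j)"
  have f: "f m = prod_list (map2 q_wt (k # u) m)" if "m \<in> ?A" for m
    unfolding f_def by (rule zeta_summand_eq) (use that in auto)
  have sub: "?F j \<subseteq> ?A" for j by (auto simp: decreasing_tuples_def)
  have "(f has_sum psum (\<lambda>a. q_wt k (Suc a) * strict_sum u a)) ?A"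
  proof (rule has_sum_fpsI[of ?F])
    fix m j assume m: "m \<in> ?A - ?F j"
    then obtain a m' where am: "m = a # m'" by (cases m) auto
    have "a > Suc j"
    proof (rule ccontr)
      assume "\<not> a > Suc j"
      then have "m \<in> ?F j"
        using m am by (auto simp: decreasing_tuples_def Suc_le_eq intro: gr0I less_imp_le order_trans) 
      with m show False by blast
    qed
    moreover have "a \<le> (k - 1) * a" using assms by (cases "k - 1") auto
    ultimately have "j < (k - 1) * a" by linarith
    moreover have "fps_X ^ ((k - 1) * a) dvd f m"
      using m f by (simp add: am q_wt_def mult.assoc)
    ultimately show "fps_nth (f m) j = 0"
      by (simp add: fps_X_power_dvd_iff)
  next
    fix j
    have "(\<Sum>m\<in>?F j. fps_nth (f m) j) = fps_nth (\<Sum>m\<in>?F j. prod_list (map2 q_wt (k # u) m)) j"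
      unfolding fps_sum_nth using sub[of j] f by (intro sum.cong refl) auto
    also have "\<dots> = fps_nth (\<Sum>a<Suc j. q_wt k (Suc a) * strict_sum u a) j"
      by (simp only: strict_sum_eq_sum_tuples strict_sum_Cons)
    finally show "fps_nth (psum (\<lambda>a. q_wt k (Suc a) * strict_sum u a)) j = (\<Sum>m\<in>?F j. fps_nth (f m) j)"
      by (simp add: psum_def fps_sum_nth lessThan_Suc_atMost del: sum.lessThan_Suc)
  qed (use sub in \<open>auto intro: finite_decreasing_tuples\<close>)
  then have "infsum f ?A = psum (\<lambda>a. q_wt k (Suc a) * strict_sum u a)"
    by (rule infsumI)
  then show ?thesis unfolding zeta_q_word_def f_def .
qed

lemma lin_eval_psum:
  assumes "\<And>u a. fps_X ^ a dvd f u a"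
  shows "lin_eval (\<lambda>u. psum (f u)) x = psum (\<lambda>a. lin_eval (\<lambda>u. f u a) x)"
  unfolding lin_eval_def psum_sum using assms by (simp add: psum_cmult)

lemma fps_X_power_dvd_q_wt:
  assumes "k \<ge> 2"
  shows "fps_X ^ a dvd q_wt k (Suc a)"
proof -
  have "a \<le> (k - 1) * Suc a" using assms by (cases "k - 1") auto
  then show ?thesis
    unfolding q_wt_def by (intro dvd_mult2 le_imp_power_dvd)
qed

text \<open>Merging the first letters into z_(i+j) forces the largest indices to agree;
  \<open>q_wt_add\<close> separates the weights again and \<open>strict_sum_star_plus_word\<close>
  factors the rest.\<close>

lemma zeta_q_circledast_word:
  assumes "u \<noteq> []" "0 \<notin> set u" "v \<noteq> []" "0 \<notin> set v"
  shows "zeta_q (circledast_word u v) = psum (\<lambda>a. fps_X ^ Suc a * (strict_term u a * strict_term v a))"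
proof -
  obtain i u' j v' where uv: "u = i # u'" "v = j # v'"
    using assms by (metis neq_Nil_conv)
  have ij: "i \<ge> 1" "j \<ge> 1" "i + j \<ge> 2" "0 \<notin> set u'" "0 \<notin> set v'"
    using assms uv by auto
  have "zeta_q (circledast_word u v) = lin_eval (\<lambda>w. zeta_q_word ((i + j) # w)) (star_plus_word u' v')"
    by (simp add: uv zeta_q_eq_lin_eval star_plus_def lin_eval_bilin_ext)
  also have "\<dots> = psum (\<lambda>a. lin_eval (\<lambda>w. q_wt (i + j) (Suc a) * strict_sum w a) (star_plus_word u' v'))"
    using ij by (simp add: zeta_q_word_Cons lin_eval_psum fps_X_power_dvd_q_wt)
  also have "\<dots> = psum (\<lambda>a. fps_X ^ Suc a * (strict_term u a * strict_term v a))"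
    unfolding lin_eval_cmult strict_sum_star_plus_word[OF ij(4,5)] q_wt_add[OF ij(1,2)]
    by (simp add: uv mult_ac)
  finally show ?thesis .
qed

section \<open>The series F_w and its coefficients\<close>

lemma z_power: "z k ^ n = word (replicate n k)"
proof (induction n)
  case 0
  show ?case by (simp add: word_def flip: single_one zero_list_def)
next
  case (Suc n)
  then show ?case by (simp add: word_def mult_single plus_list_def)
qed

definition dual_coeff :: "ncpoly \<Rightarrow> nat \<Rightarrow> rat fps" where
  "dual_coeff w a = lin_eval (\<lambda>u. d_term (phi_list u) a) w"

text \<open>The coefficient of t^n in F_w, extended linearly in w. For n = 0 the default value 0 of
  \<open>strict_term []\<close> makes the constant term vanish.\<close>

definition kawashima_coeff :: "ncpoly \<Rightarrow> nat \<Rightarrow> rat fps" where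
  "kawashima_coeff w n = psum (\<lambda>a. fps_X ^ Suc a * (dual_coeff w a * strict_term (replicate n 1) a))"

lemma kawashima_coeff_0 [simp]: "kawashima_coeff w 0 = 0"
  by (simp add: kawashima_coeff_def psum_def fps_eq_iff)

lemma zeta_q_circledast_dual:
  assumes "w \<in> h1_pos" "n \<ge> 1"
  shows "zeta_q (circledast (d_map (phi w)) (z 1 ^ n)) = kawashima_coeff w n"
proof -
  define r where "r = replicate n (1::nat)"
  have r: "r \<noteq> []" "0 \<notin> set r" using assms by (auto simp: r_def)
  have over: "d_map (phi w) \<in> over {u. u \<noteq> [] \<and> 0 \<notin> set u}"
    using assms d_map_h1_pos phi_h1_pos by (simp add: carriers_over)
  have dc: "dual_coeff w a = lin_eval (\<lambda>u. strict_term u a) (d_map (phi w))" for a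
    by (simp add: d_map_def phi_def lin_eval_lin_ext d_term_def dual_coeff_def)
  have "zeta_q (circledast (d_map (phi w)) (z 1 ^ n)) =
      lin_eval (\<lambda>u. zeta_q (circledast_word u r)) (d_map (phi w))"
    by (simp only: z_power zeta_q_eq_lin_eval circledast_def lin_eval_bilin_ext lin_eval_word r_def)
  also have "\<dots> = lin_eval (\<lambda>u. psum (\<lambda>a. fps_X ^ Suc a * (strict_term u a * strict_term r a))) (d_map (phi w))"
    by (rule lin_eval_cong[OF over]) (simp add: zeta_q_circledast_word r)
  also have "\<dots> = psum (\<lambda>a. lin_eval (\<lambda>u. fps_X ^ Suc a * (strict_term u a * strict_term r a)) (d_map (phi w)))"
    by (rule lin_eval_psum) (intro dvd_mult2 le_imp_power_dvd, simp)
  also have "\<dots> = kawashima_coeff w n"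
    by (simp only: kawashima_coeff_def dc lin_eval_cmult lin_eval_cmult_right r_def)
  finally show ?thesis .
qed

lemma strict_sum_replicate_eq_0: "n > M \<Longrightarrow> strict_sum (replicate n k) M = 0"
proof (induction M arbitrary: n)
  case (Suc M)
  then obtain n' where "n = Suc n'" "n' > M" by (cases n) auto
  then show ?case using Suc.IH[of n'] Suc.IH[of "Suc n'"] by simp
qed (auto simp: gr0_conv_Suc)

lemma strict_term_replicate_eq_0: "n > Suc a \<Longrightarrow> strict_term (replicate n k) a = 0"
  by (cases n) (simp_all add: strict_sum_replicate_eq_0)

text \<open>For n <= \<open>Suc a\<close> the factor q^(a+1) suffices; for larger n no strictly
  decreasing n-tuple of positive integers starts at \<open>Suc a\<close>, so the term is 0.\<close>

lemma fps_X_power_dvd_kawashima_term: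
  "fps_X ^ n dvd fps_X ^ Suc a * (b * strict_term (replicate n k) a)"
proof (cases "n > Suc a")
  case False
  then show ?thesis by (intro dvd_mult2 le_imp_power_dvd) simp
qed (simp add: strict_term_replicate_eq_0)

lemma fps_X_power_dvd_kawashima_coeff: "fps_X ^ n dvd kawashima_coeff w n"
  unfolding kawashima_coeff_def by (intro psum_dvd fps_X_power_dvd_kawashima_term)

text \<open>These sums are the elementary symmetric polynomials in 1/[1], ..., 1/[M], with
  generating polynomial the product of the factors 1 + t/[j].\<close>

lemma strict_sum_replicate_generating:
  "(\<Sum>n\<le>Suc M. strict_sum (replicate n 1) (Suc M) * t ^ n)
    = (1 + t * inverse (q_int (Suc M))) * (\<Sum>n\<le>M. strict_sum (replicate n 1) M * t ^ n)"
proof -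
  let ?s = "\<lambda>n. strict_sum (replicate n 1) M * t ^ n"
  have "(\<Sum>n\<le>Suc M. strict_sum (replicate n 1) (Suc M) * t ^ n) =
      1 + (\<Sum>n\<le>M. ?s (Suc n) + t * inverse (q_int (Suc M)) * ?s n)"
    by (subst sum.atMost_Suc_shift) (simp add: q_wt_one[unfolded One_nat_def] algebra_simps)
  also have "\<dots> = (\<Sum>n\<le>Suc M. ?s n) + t * inverse (q_int (Suc M)) * (\<Sum>n\<le>M. ?s n)"
    by (subst sum.atMost_Suc_shift) (simp add: sum.distrib sum_distrib_left)
  also have "(\<Sum>n\<le>Suc M. ?s n) = (\<Sum>n\<le>M. ?s n)"
    by (simp add: strict_sum_replicate_eq_0 del: replicate_Suc)
  finally show ?thesis by (simp add: algebra_simps)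
qed

section \<open>The quadratic relation\<close>

text \<open>At t = -[N] the factor 1 + t/[j] is ([j] - [N])/[j], so t/[m] times the product over j <
  m obeys the recursion of \<open>q_newton\<close>.\<close>

lemma strict_term_replicate_generating:
  "(\<Sum>n\<le>Suc a. strict_term (replicate n 1) a * (- q_int N) ^ n) = q_newton (Suc a) N"
proof -
  define t where "t = - q_int N"
  let ?E = "\<lambda>M. \<Sum>n\<le>M. strict_sum (replicate n 1) M * t ^ n"
  have newton: "q_newton (Suc a) N = t * inverse (q_int (Suc a)) * ?E a"
  proof (induction a)
    case 0
    show ?case by (simp add: t_def)
  next
    case (Suc a)
    have "q_newton (Suc (Suc a)) N = (q_int (Suc a) + t) * inverse (q_int (Suc (Suc a))) * (t * inverse (q_int (Suc a)) * ?E a)"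
      by (subst q_newton.simps(2)) (simp only: Suc, simp add: t_def)
    also have "\<dots> = t * inverse (q_int (Suc (Suc a))) *
        ((q_int (Suc a) * inverse (q_int (Suc a)) + t * inverse (q_int (Suc a))) * ?E a)"
      by (simp only: distrib_left distrib_right mult_ac)
    finally show ?case
      by (simp only: q_int_inverse strict_sum_replicate_generating)
  qed
  have "(\<Sum>n\<le>Suc a. strict_term (replicate n 1) a * t ^ n) = t * inverse (q_int (Suc a)) * ?E a"
    by (subst sum.atMost_Suc_shift) (simp add: q_wt_one[unfolded One_nat_def] sum_distrib_left mult_ac)
  then show ?thesis by (simp only: newton t_def)
qed

text \<open>After exchanging the sums, the inner sum over n is finite and produces
  \<open>q_newton (Suc a) N\<close>, which vanishes for a >= N; the remaining Newton sum is
  evaluated word by word with \<open>q_newton_sum_dual\<close>.\<close>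

lemma ps_eval_kawashima_coeff:
  assumes "w \<in> h1_pos"
  shows "ps_eval (kawashima_coeff w) (- q_int N) = - lin_eval (\<lambda>u. weak_sum u N) w"
proof -
  define g where "g n a = fps_X ^ Suc a * (dual_coeff w a * strict_term (replicate n 1) a) * (- q_int N) ^ n" for n a
  have dvd: "fps_X ^ n dvd g n a" for n a
    unfolding g_def by (intro dvd_mult2[of _ _ "_ ^ _"] fps_X_power_dvd_kawashima_term)
  have "ps_eval (kawashima_coeff w) (- q_int N) = psum (\<lambda>n. psum (g n))"
    unfolding ps_eval_def
  proof (rule arg_cong[of _ _ psum], rule ext)
    fix n
    have "psum (\<lambda>a. (- q_int N) ^ n * (fps_X ^ Suc a * (dual_coeff w a * strict_term (replicate n 1) a)))
        = (- q_int N) ^ n * kawashima_coeff w n"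
      unfolding kawashima_coeff_def by (rule psum_cmult) (intro dvd_mult2 le_imp_power_dvd, simp)
    then show "kawashima_coeff w n * (- q_int N) ^ n = psum (g n)"
      by (simp only: g_def[abs_def] mult.commute[of "(- q_int N) ^ n"])
  qed
  also have "\<dots> = psum (\<lambda>a. psum (\<lambda>n. g n a))"
    by (rule psum_swap)
  also have "\<dots> = psum (\<lambda>a. q_newton (Suc a) N * (fps_X ^ Suc a * dual_coeff w a))"
  proof (rule arg_cong[of _ _ psum], rule ext)
    fix a
    have "psum (\<lambda>n. g n a) = (\<Sum>n<Suc (Suc a). g n a)"
      by (rule psum_finite) (use dvd in \<open>auto simp: g_def strict_term_replicate_eq_0\<close>)
    also have "\<dots> = fps_X ^ Suc a * dual_coeff w a * (\<Sum>n\<le>Suc a. strict_term (replicate n 1) a * (- q_int N) ^ n)"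
      unfolding g_def sum_distrib_left lessThan_Suc_atMost by (simp only: mult.assoc)
    also have "\<dots> = q_newton (Suc a) N * (fps_X ^ Suc a * dual_coeff w a)"
      unfolding strict_term_replicate_generating by (simp only: mult_ac)
    finally show "psum (\<lambda>n. g n a) = q_newton (Suc a) N * (fps_X ^ Suc a * dual_coeff w a)" .
  qed
  also have "\<dots> = (\<Sum>a<N. q_newton (Suc a) N * (fps_X ^ Suc a * dual_coeff w a))"
  proof (rule psum_finite)
    show "fps_X ^ a dvd q_newton (Suc a) N * (fps_X ^ Suc a * dual_coeff w a)" for a
      by (intro dvd_mult dvd_mult2 le_imp_power_dvd) simp
  qed (simp add: q_newton_eq_0 del: q_newton.simps)
  also have "\<dots> = lin_eval (\<lambda>u. q_newton_sum (\<lambda>a. fps_X ^ Suc a * d_term (phi_list u) a) N) w"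
    by (simp only: q_newton_sum_def dual_coeff_def lin_eval_fun_sum lin_eval_cmult)
  also have "\<dots> = lin_eval (\<lambda>u. - weak_sum u N) w"
    using assms unfolding carriers_over by (rule lin_eval_cong) (rule q_newton_sum_dual, auto)
  finally show ?thesis by (simp only: lin_eval_fun_uminus)
qed

theorem theorem4p6:
  fixes w1 w2 :: ncpoly and n :: nat
  assumes "w1 \<in> h1_pos" and "w2 \<in> h1_pos" and "n \<ge> 1"
  shows "zeta_q (circledast (d_map (phi (star_bar w1 w2))) (z 1 ^ n))
       + (\<Sum>(k, l)\<in>{(k, l). k + l = n \<and> k \<ge> 1 \<and> l \<ge> 1}.
            zeta_q (circledast (d_map (phi w1)) (z 1 ^ k))
          * zeta_q (circledast (d_map (phi w2)) (z 1 ^ l))) = 0"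
proof -
  let ?Y = "kawashima_coeff w1" and ?Z = "kawashima_coeff w2"
  \<comment> \<open>The coefficient of t^n in F of the product plus the product of the two series
    F.\<close>
  define G where "G n = kawashima_coeff (star_bar w1 w2) n + (\<Sum>k\<le>n. ?Y k * ?Z (n - k))" for n
  have w12: "star_bar w1 w2 \<in> h1_pos"
    using assms by (intro star_bar_h1_pos)
  \<comment> \<open>With S_1, S_2 the weak sums of w1, w2 at N, this reads -S_1 S_2 + (-S_1)(-S_2) =
    0.\<close>
  have "ps_eval G (- q_int N) = 0" for N
    unfolding G_def ps_eval_add
    by (simp add: ps_eval_mult fps_X_power_dvd_kawashima_coeff ps_eval_kawashima_coeff w12 assms weak_sum_star_bar)
  then have "range (\<lambda>N. - q_int N) \<subseteq> {t. ps_eval G t = 0}" by blast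
  moreover have "infinite (range (\<lambda>N. - q_int N))"
    by (rule range_inj_infinite) (use inj_q_int in \<open>auto simp: inj_def\<close>)
  ultimately have zeros: "infinite {t. ps_eval G t = 0}"
    by (rule infinite_super)
  have "fps_X ^ n dvd G n" for n
    unfolding G_def
  proof (intro dvd_add dvd_sum fps_X_power_dvd_kawashima_coeff)
    fix k assume "k \<in> {..n}"
    then have "n = k + (n - k)" by simp
    then show "fps_X ^ n dvd ?Y k * ?Z (n - k)"
      by (metis power_add mult_dvd_mono fps_X_power_dvd_kawashima_coeff)
  qed
  then have "G n = 0"
    using zeros by (rule infinite_zeros_imp_zero)
  moreover have "(\<Sum>(k, l)\<in>{(k, l). k + l = n \<and> k \<ge> 1 \<and> l \<ge> 1}.
            zeta_q (circledast (d_map (phi w1)) (z 1 ^ k)) * zeta_q (circledast (d_map (phi w2)) (z 1 ^ l)))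
      = (\<Sum>k\<le>n. ?Y k * ?Z (n - k))"
  proof -
    have "(\<Sum>(k, l)\<in>{(k, l). k + l = n \<and> k \<ge> 1 \<and> l \<ge> 1}.
            zeta_q (circledast (d_map (phi w1)) (z 1 ^ k)) * zeta_q (circledast (d_map (phi w2)) (z 1 ^ l)))
        = (\<Sum>(k, l)\<in>{(k, l). k + l = n \<and> k \<ge> 1 \<and> l \<ge> 1}. ?Y k * ?Z l)"
      using assms by (intro sum.cong refl) (auto simp: zeta_q_circledast_dual simp del: One_nat_def)
    also have "\<dots> = (\<Sum>k\<in>{1..<n}. ?Y k * ?Z (n - k))"
      by (rule sum.reindex_bij_witness[of _ "\<lambda>k. (k, n - k)" fst]) auto
    \<comment> \<open>The added terms k = 0 and k = n vanish, since neither series has a constant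
      term.\<close>
    also have "\<dots> = (\<Sum>k\<le>n. ?Y k * ?Z (n - k))"
    proof (rule sum.mono_neutral_left)
      show "\<forall>k\<in>{..n} - {1..<n}. ?Y k * ?Z (n - k) = 0"
      proof
        fix k assume "k \<in> {..n} - {1..<n}"
        then have "k = 0 \<or> k = n" by auto
        then show "?Y k * ?Z (n - k) = 0" by auto
      qed
    qed auto
    finally show ?thesis .
  qed
  ultimately show ?thesis
    using assms w12 by (simp add: G_def zeta_q_circledast_dual del: One_nat_def)
qed

end
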